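(* Let $K$ be a positive integer and let $\gamma_0,\dots,\gamma_K$ be real numbers with $\gamma_0=1$ and $\gamma_K\neq 0$. Let $\hat{\mathcal H}_n(x)=H_n(x)/(2^nn!)$ for $n\ge 0$ and $\hat{\mathcal H}_n=0$ for $n<0$, and for $n\ge 0$ put $$q_n(x)=\sum_{j=0}^K\gamma_j\hat{\mathcal H}_{n-j}(x).$$ Let $P(x)=\sum_{j=0}^K\gamma_jx^{K-j}$ and let $N^{\mathrm{nr}}$ be the number of non-real zeros of $P$ (counted with multiplicity). Then: (1) $q_n$ has only real zeros for all $n\ge 0$ if and only if $N^{\mathrm{nr}}=0$; moreover, in that case the zeros of $q_n$ are simple and the zeros of $q_{n+1}$ interlace the zeros of $q_n$. (2) If $N^{\mathrm{nr}}>0$, then there exists a nonnegative integer $n_0$ (taken to be the smallest such) such that $q_{n_0}$ has exactly $N^{\mathrm{nr}}$ non-real zeros. Moreover, $q_n$ has exactly $n-N^{\mathrm{nr}}$ real zeros and $N^{\mathrm{nr}}$ non-real zeros if and only if $n\ge n_0$, in which case the real zeros are simple and the real zeros of $q_{n+1}$ interlace the real zeros of $q_n$.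
   Context: $H_n$ denotes the standard (physicists') Hermite polynomial of degree $n$ (orthogonal with respect to $e^{-x^2}$, leading coefficient $2^n$). With this normalization $q_n'=q_{n-1}$. Interlacing: given two finite sets $U,V$ of real numbers, $U$ (strictly) interlaces $V$ if $\min U<\min V$ and between any two consecutive elements of either of the two sets there is an element of the other; "the zeros of $p$ interlace the zeros of $q$" means the corresponding sets of zeros satisfy this. *)

theory Defs
  imports Complex_Main "HOL-Computational_Algebra.Polynomial"
begin

text \<open>Physicists' Hermite polynomials H_n (leading coefficient 2^n), via the
  three-term recurrence H_{n+1} = 2x H_n - 2n H_{n-1}.\<close>
fun hermite :: "nat \<Rightarrow> real poly" where
  "hermite 0 = 1"
| "hermite (Suc 0) = [:0, 2:]"
| "hermite (Suc (Suc n)) = [:0, 2:] * hermite (Suc n) - smult (2 * (real n + 1)) (hermite n)"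

definition hat_hermite :: "int \<Rightarrow> real poly" where
  "hat_hermite n = (if n < 0 then 0
     else smult (1 / (2 ^ nat n * fact (nat n))) (hermite (nat n)))"

definition qpoly :: "(nat \<Rightarrow> real) \<Rightarrow> nat \<Rightarrow> nat \<Rightarrow> real poly" where
  "qpoly \<gamma> K n = (\<Sum>j = 0..K. smult (\<gamma> j) (hat_hermite (int n - int j)))"

definition Ppoly :: "(nat \<Rightarrow> real) \<Rightarrow> nat \<Rightarrow> real poly" where
  "Ppoly \<gamma> K = (\<Sum>j = 0..K. monom (\<gamma> j) (K - j))"

definition nonreal_zero_count :: "real poly \<Rightarrow> nat" where
  "nonreal_zero_count p =
     (\<Sum>z\<in>{z::complex. poly (map_poly complex_of_real p) z = 0 \<and> Im z \<noteq> 0}.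
        order z (map_poly complex_of_real p))"

definition real_zero_count :: "real poly \<Rightarrow> nat" where
  "real_zero_count p = (\<Sum>x\<in>{x::real. poly p x = 0}. order x p)"

definition real_zeros :: "real poly \<Rightarrow> real set" where
  "real_zeros p = {x. poly p x = 0}"

text \<open>Strict interlacing of finite sets: min U < min V (with min of the empty set
  read as +infinity) and between two consecutive elements of either set there is an
  element of the other.\<close>
definition interlaces :: "real set \<Rightarrow> real set \<Rightarrow> bool" where
  "interlaces U V \<longleftrightarrow>
     (V \<noteq> {} \<longrightarrow> U \<noteq> {} \<and> Min U < Min V) \<and>
     (\<forall>a\<in>U. \<forall>b\<in>U. a < b \<and> \<not> (\<exists>c\<in>U. a < c \<and> c < b) \<longrightarrow> (\<exists>v\<in>V. a < v \<and> v < b)) \<and>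
     (\<forall>a\<in>V. \<forall>b\<in>V. a < b \<and> \<not> (\<exists>c\<in>V. a < c \<and> c < b) \<longrightarrow> (\<exists>u\<in>U. a < u \<and> u < b))"

end

theory Submission
  imports
    Defs
    "HOL-Complex_Analysis.Residue_Theorem"
    "HOL-Computational_Algebra.Fundamental_Theorem_Algebra"
    "HOL-Computational_Algebra.Polynomial_FPS"
begin

text \<open>
  Let $Q(t) = \sum_j \gamma_j t^j$ be the reversal of $P$, so that
  $\sum_n q_n(x) t^n = Q(t) e^{xt - t^2/4}$ and $q_{n+1}' = q_n$. By Rolle's theorem the number of
  non-real zeros of $q_n$ is nondecreasing in $n$. It never exceeds $N$: up to a reversal and a
  rescaling, $q_n$ is a Jensen polynomial of the function $Q(t) e^{-t^2/4}$, which is a limit of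
  polynomials with $N$ non-real zeros, and the passage to Jensen polynomials does not create non-real
  zeros. It reaches $N$ because $n!\,n^{-n} w^n q_n(n/w)$ tends to $Q(w) e^{-w^2/4}$ locally
  uniformly, so that Rouche's theorem puts zeros of $q_n$ near $n/w_0$ for every zero $w_0$ of $Q$.
  Once the number of non-real zeros is constant, $q_{n+1}' = q_n$ has no real zeros besides those
  that Rolle's theorem provides, and this gives simplicity and interlacing.
\<close>

section \<open>Semicontinuity of the number of non-real zeros\<close>

text \<open>A limit controls non-real zeros in one direction only: those of the limit persist in the
  approximants, while those of the approximants may collapse onto the real axis or escape to
  infinity. Both bounds are arranged to fit this direction: for the upper bound q_n is the limit,
  for the lower bound q_n (reversed and rescaled) is the approximant. The second limit is not a
  polynomial, so the Rouche argument carries a zero-free entire factor \<open>E\<close>. On the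
  other side, Rolle's theorem is the only tool: the multiplier 1/j! behind the Jensen polynomials is
  itself obtained from derivatives of x^M p(x), and e^{-t^2/4} is approximated by (1 - t^2/(4m))^m
  because the latter has only real zeros. A constant count does not by itself exclude common zeros
  of q_{n+1} and q_n; these are excluded because a multiple zero would survive in all later
  polynomials.\<close>

lemma order_eqI:
  fixes p :: "'a::idom poly"
  assumes "p = [:- a, 1:] ^ n * q" "poly q a \<noteq> 0"
  shows "order a p = n"
proof -
  have "q \<noteq> 0" using assms(2) by auto
  then have "order a p = order a ([:- a, 1:] ^ n) + order a q"
    unfolding assms(1) by (intro order_mult) simp
  then show ?thesis using assms(2) by (simp add: order_power_n_n order_0I)
qed

lemma zorder_poly_mult:
  fixes p :: "complex poly"
  assumes "p \<noteq> 0" "E holomorphic_on UNIV" "E z \<noteq> 0"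
  shows "zorder (\<lambda>w. poly p w * E w) z = int (order z p)"
proof -
  obtain q where q: "p = [:- z, 1:] ^ order z p * q" "\<not> [:- z, 1:] dvd q"
    using order_decomp[OF assms(1)] by blast
  have "poly q z \<noteq> 0" using q(2) by (simp add: poly_eq_0_iff_dvd)
  show ?thesis
  proof (rule zorder_eqI[where S = UNIV and g = "\<lambda>w. poly q w * E w"])
    show "(\<lambda>w. poly q w * E w) holomorphic_on UNIV"
      by (intro holomorphic_intros assms)
    show "poly q z * E z \<noteq> 0" using \<open>poly q z \<noteq> 0\<close> assms(3) by simp
    fix w assume "w \<noteq> z"
    show "poly p w * E w = poly q w * E w * (w - z) powi int (order z p)"
      by (subst q(1)) (simp add: poly_power)
  qed auto
qed

text \<open>Hurwitz's theorem with multiplicities, at a single zero. On the circle |p E| has a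
  positive minimum, and uniform convergence eventually makes the perturbation smaller, so Rouche's
  theorem applies; \<open>E\<close> has no zeros and leaves the count alone.\<close>

lemma order_sum_ball_eq:
  fixes p :: "complex poly" and E :: "complex \<Rightarrow> complex" and f :: "nat \<Rightarrow> complex poly"
  assumes p: "p \<noteq> 0" and E: "E holomorphic_on UNIV" "\<And>w. E w \<noteq> 0" and f: "\<And>n. f n \<noteq> 0"
    and r: "0 < r" and only: "\<And>w. w \<in> cball z r \<Longrightarrow> poly p w = 0 \<Longrightarrow> w = z"
    and lim: "uniform_limit (cball z r) (\<lambda>n. poly (f n)) (\<lambda>w. poly p w * E w) sequentially"
  shows "\<forall>\<^sub>F n in sequentially.
    (\<Sum>w\<in>{w\<in>ball z r. poly (f n) w = 0}. order w (f n)) = order z p"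
proof -
  define g where "g = (\<lambda>w. poly p w * E w)"
  have g_hol: "g holomorphic_on UNIV" unfolding g_def by (intro holomorphic_intros E)
  have "continuous_on (sphere z r) (\<lambda>w. norm (g w))"
    by (intro continuous_intros holomorphic_on_imp_continuous_on holomorphic_on_subset[OF g_hol]) auto
  moreover have "sphere z r \<noteq> {}" using r by simp
  ultimately obtain w0 where w0: "w0 \<in> sphere z r" "\<forall>w\<in>sphere z r. norm (g w0) \<le> norm (g w)"
    using continuous_attains_inf[of "sphere z r" "\<lambda>w. norm (g w)"] by auto
  have w0': "w0 \<noteq> z" "w0 \<in> cball z r" using w0(1) r by auto
  then have pos: "norm (g w0) > 0" using only[of w0] E(2) by (auto simp: g_def)
  have "\<forall>\<^sub>F n in sequentially. \<forall>w\<in>cball z r. dist (poly (f n) w) (g w) < norm (g w0)"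
    using uniform_limitD[OF lim pos] by (simp add: g_def)
  then show ?thesis
  proof eventually_elim
    case (elim n)
    define h where "h = (\<lambda>w. poly (f n) w - g w)"
    have fg: "(\<lambda>w. g w + h w) = poly (f n)" by (simp add: h_def)
    have fin: "finite {w. poly (f n) w = 0}" using f poly_roots_finite by blast
    have g0: "{w. g w = 0} = {w. poly p w = 0}" using E(2) by (auto simp: g_def)
    have fing: "finite {w. g w = 0}" unfolding g0 using p poly_roots_finite by blast
    have less: "norm (h w) < norm (g w)" if "w \<in> sphere z r" for w
    proof -
      have "norm (h w) < norm (g w0)" using elim that by (auto simp: h_def dist_norm)
      also have "\<dots> \<le> norm (g w)" using w0 that by blast
      finally show ?thesis .
    qed
    \<comment> \<open>Rouche's theorem sums over all zeros in the plane; the winding numbers cut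
      both sums down to the ball. By \<open>less\<close> neither function vanishes on the
      circle.\<close>
    have wn: "winding_number (circlepath z r) w = (if w \<in> ball z r then 1 else 0)"
      if "w \<notin> sphere z r" for w
    proof (cases "w \<in> ball z r")
      case True
      then show ?thesis by (simp add: winding_number_circlepath dist_norm norm_minus_commute)
    next
      case False
      then have "w \<notin> cball z r" using that by auto
      then show ?thesis using False r
        by (subst winding_number_zero_outside[where s = "cball z r"]) auto
    qed
    have "(\<Sum>w\<in>{w\<in>UNIV. g w + h w = 0}. winding_number (circlepath z r) w * zorder (\<lambda>w. g w + h w) w)
        = (\<Sum>w\<in>{w\<in>UNIV. g w = 0}. winding_number (circlepath z r) w * zorder g w)"
    proof (rule Rouche_theorem)
      show "h holomorphic_on UNIV" unfolding h_def by (intro holomorphic_intros g_hol)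
      show "\<forall>w\<in>path_image (circlepath z r). norm (h w) < norm (g w)" using less r by auto
    qed (use fin fing g_hol in \<open>auto simp: h_def\<close>)
    moreover have "(\<Sum>w\<in>{w\<in>UNIV. g w + h w = 0}. winding_number (circlepath z r) w * zorder (\<lambda>w. g w + h w) w)
       = (\<Sum>w\<in>{w. poly (f n) w = 0}. if w \<in> ball z r then of_nat (order w (f n)) else 0)"
    proof (rule sum.cong)
      fix w assume w: "w \<in> {w. poly (f n) w = 0}"
      then have "w \<notin> sphere z r" using less[of w] by (auto simp: h_def)
      moreover have "zorder (poly (f n)) w = int (order w (f n))"
        using zorder_poly_mult[of "f n" "\<lambda>_. 1" w] f by simp
      ultimately show "winding_number (circlepath z r) w * zorder (\<lambda>w. g w + h w) w
          = (if w \<in> ball z r then of_nat (order w (f n)) else 0)"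
        unfolding fg using wn[of w] by simp
    qed (simp add: h_def)
    moreover have "(\<Sum>w\<in>{w\<in>UNIV. g w = 0}. winding_number (circlepath z r) w * zorder g w)
       = (\<Sum>w\<in>{w. poly p w = 0}. if w = z then of_nat (order w p) else 0)"
    proof (rule sum.cong)
      fix w assume w: "w \<in> {w. poly p w = 0}"
      then have "w \<notin> sphere z r" using less[of w] by (auto simp: g_def)
      moreover have "zorder g w = int (order w p)"
        unfolding g_def using zorder_poly_mult[of p E w] p E by simp
      moreover have "w \<in> ball z r \<longleftrightarrow> w = z" using only[of w] w r by auto
      ultimately show "winding_number (circlepath z r) w * zorder g w
          = (if w = z then of_nat (order w p) else 0)"
        using wn[of w] by simp
    qed (use g0 in simp)
    moreover have "(\<Sum>w\<in>{w. poly p w = 0}. if w = z then of_nat (order w p) else 0)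
        = (of_nat (order z p) :: complex)"
      using p poly_roots_finite[OF p] by (auto simp: sum.delta order_0I)
    moreover have "(\<Sum>w\<in>{w. poly (f n) w = 0}. if w \<in> ball z r then of_nat (order w (f n)) else 0)
        = (of_nat (\<Sum>w\<in>{w\<in>ball z r. poly (f n) w = 0}. order w (f n)) :: complex)"
      using fin by (auto simp: sum.If_cases of_nat_sum Int_def conj_commute intro!: sum.cong)
    ultimately have "(of_nat (\<Sum>w\<in>{w\<in>ball z r. poly (f n) w = 0}. order w (f n)) :: complex)
        = of_nat (order z p)" by simp
    then show ?case by (simp only: of_nat_eq_iff)
  qed
qed

definition nonreal_order_sum :: "complex poly \<Rightarrow> nat" where
  "nonreal_order_sum p = (\<Sum>z\<in>{z. poly p z = 0 \<and> Im z \<noteq> 0}. order z p)"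

text \<open>Disjoint discs around the non-real zeros of \<open>p\<close>, off the real axis, each
  eventually hold as many zeros of \<open>f n\<close> as the order of the centre. Equality can fail:
  further non-real zeros of \<open>f n\<close> may tend to real zeros of \<open>p\<close> or to
  infinity.\<close>

lemma nonreal_order_sum_le_eventually:
  fixes p :: "complex poly" and E :: "complex \<Rightarrow> complex" and f :: "nat \<Rightarrow> complex poly"
  assumes p: "p \<noteq> 0" and E: "E holomorphic_on UNIV" "\<And>w. E w \<noteq> 0" and f: "\<And>n. f n \<noteq> 0"
    and lim: "\<And>\<rho>. uniform_limit (cball 0 \<rho>) (\<lambda>n. poly (f n)) (\<lambda>w. poly p w * E w) sequentially"
  shows "\<forall>\<^sub>F n in sequentially. nonreal_order_sum p \<le> nonreal_order_sum (f n)"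
proof -
  define A where "A = {z. poly p z = 0 \<and> Im z \<noteq> 0}"
  have finp: "finite {z. poly p z = 0}" by (rule poly_roots_finite[OF p])
  have finA: "finite A" unfolding A_def by (rule finite_subset[OF _ finp]) auto
  have "\<exists>d>0. (\<forall>w. poly p w = 0 \<longrightarrow> w \<noteq> z \<longrightarrow> d \<le> dist z w) \<and> d \<le> \<bar>Im z\<bar>" if z: "z \<in> A" for z
  proof -
    obtain d where "d > 0" "\<forall>w\<in>{z. poly p z = 0}. w \<noteq> z \<longrightarrow> d \<le> dist z w"
      using finite_set_avoid[OF finp, of z] by blast
    then show ?thesis using z by (intro exI[of _ "min d \<bar>Im z\<bar>"]) (auto simp: A_def)
  qed
  then obtain d where d: "\<And>z. z \<in> A \<Longrightarrow> d z > 0"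
    "\<And>z w. z \<in> A \<Longrightarrow> poly p w = 0 \<Longrightarrow> w \<noteq> z \<Longrightarrow> d z \<le> dist z w"
    "\<And>z. z \<in> A \<Longrightarrow> d z \<le> \<bar>Im z\<bar>" by metis
  \<comment> \<open>With one third, r z + r z' is at most 2/3 of dist z z', so the balls are
    disjoint, and they stay off the real axis since d z is at most |Im z|.\<close>
  define r where "r z = d z / 3" for z
  have ev: "\<forall>\<^sub>F n in sequentially. \<forall>z\<in>A.
     (\<Sum>w\<in>{w\<in>ball z (r z). poly (f n) w = 0}. order w (f n)) = order z p"
  proof (rule eventually_ball_finite[OF finA], rule ballI)
    fix z assume z: "z \<in> A"
    have sub: "cball z (r z) \<subseteq> cball 0 (norm z + r z)"
      by (rule subset_trans[OF _ order_refl]) (auto simp: dist_norm, norm)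
    show "\<forall>\<^sub>F n in sequentially.
        (\<Sum>w\<in>{w\<in>ball z (r z). poly (f n) w = 0}. order w (f n)) = order z p"
    proof (rule order_sum_ball_eq[OF p E f])
      show "0 < r z" using d(1)[OF z] by (simp add: r_def)
      fix w assume "w \<in> cball z (r z)" "poly p w = 0"
      then show "w = z" using d(1)[OF z] d(2)[OF z, of w] by (force simp: r_def)
    qed (rule uniform_limit_on_subset[OF lim sub])
  qed
  have disj: "ball z (r z) \<inter> ball z' (r z') = {}" if "z \<in> A" "z' \<in> A" "z \<noteq> z'" for z z'
  proof (rule ccontr)
    assume "ball z (r z) \<inter> ball z' (r z') \<noteq> {}"
    then obtain w where "dist z w < r z" "dist z' w < r z'" by auto
    then have "dist z z' < r z + r z'"
      using dist_triangle2[of z z' w] by linarith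
    moreover have "d z \<le> dist z z'" "d z' \<le> dist z z'"
      using d(2)[of z z'] d(2)[of z' z] that by (auto simp: A_def dist_commute)
    ultimately show False using d(1)[OF that(1)] by (simp add: r_def)
  qed
  have nonreal: "Im w \<noteq> 0" if "z \<in> A" "w \<in> ball z (r z)" for z w
  proof
    assume "Im w = 0"
    then have "\<bar>Im z\<bar> \<le> dist z w" using abs_Im_le_cmod[of "z - w"] by (simp add: dist_norm)
    then show False using d(1,3)[OF that(1)] that(2) by (simp add: r_def)
  qed
  show ?thesis using ev
  proof eventually_elim
    case (elim n)
    have fin: "finite {w. poly (f n) w = 0}" using f poly_roots_finite by blast
    have "nonreal_order_sum p = (\<Sum>z\<in>A. \<Sum>w\<in>{w\<in>ball z (r z). poly (f n) w = 0}. order w (f n))"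
      using elim by (simp add: nonreal_order_sum_def A_def)
    also have "\<dots> = (\<Sum>w\<in>(\<Union>z\<in>A. {w\<in>ball z (r z). poly (f n) w = 0}). order w (f n))"
    proof (rule sum.UNION_disjoint[symmetric, OF finA])
      show "\<forall>z\<in>A. finite {w \<in> ball z (r z). poly (f n) w = 0}"
        by (auto intro: finite_subset[OF _ fin])
      show "\<forall>i\<in>A. \<forall>j\<in>A. i \<noteq> j \<longrightarrow> {w \<in> ball i (r i). poly (f n) w = 0} \<inter>
             {w \<in> ball j (r j). poly (f n) w = 0} = {}"
        using disj by blast
    qed
    also have "\<dots> \<le> nonreal_order_sum (f n)"
      unfolding nonreal_order_sum_def
      by (rule sum_mono2) (use nonreal in \<open>auto intro: finite_subset[OF _ fin]\<close>)
    finally show ?case .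
  qed
qed

text \<open>Dominated convergence for power series: on the disc the error is at most the sum over k
  of \<open>T k n\<close>, which does not depend on the point and tends to 0 by Tannery's
  theorem.\<close>

lemma uniform_limit_poly_dominated:
  fixes f :: "nat \<Rightarrow> complex poly" and c :: "nat \<Rightarrow> complex"
  assumes bound: "\<And>n k. norm (coeff (f n) k) \<le> B k"
    and summ: "\<And>\<rho>. \<rho> > 0 \<Longrightarrow> summable (\<lambda>k. B k * \<rho> ^ k)"
    and lim: "\<And>k. (\<lambda>n. coeff (f n) k) \<longlonglongrightarrow> c k"
    and F: "\<And>z. (\<lambda>k. c k * z ^ k) sums F z"
  shows "uniform_limit (cball 0 \<rho>) (\<lambda>n. poly (f n)) F sequentially"
proof -
  \<comment> \<open>The majorant is assumed summable at positive radii, while \<open>\<rho>\<close>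
    is arbitrary.\<close>
  define \<sigma> where "\<sigma> = max 1 \<rho>"
  have \<sigma>: "\<sigma> > 0" "\<rho> \<le> \<sigma>" by (auto simp: \<sigma>_def)
  have cB: "norm (c k) \<le> B k" for k
    by (rule tendsto_upperbound[OF tendsto_norm[OF lim]]) (simp_all add: bound)
  have B0: "B k \<ge> 0" for k using norm_ge_zero cB order_trans by blast
  define T where "T k n = norm (coeff (f n) k - c k) * \<sigma> ^ k" for k n
  have Tb: "norm (T k n) \<le> 2 * (B k * \<sigma> ^ k)" for k n
  proof -
    have "norm (coeff (f n) k - c k) \<le> B k + B k"
      using norm_triangle_ineq4[of "coeff (f n) k" "c k"] bound[of n k] cB[of k] by linarith
    then show ?thesis using \<sigma> mult_right_mono[of "norm (coeff (f n) k - c k)" "B k + B k" "\<sigma> ^ k"]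
      by (simp add: T_def abs_mult)
  qed
  have "(\<lambda>n. T k n) \<longlonglongrightarrow> 0" for k
    unfolding T_def using tendsto_mult_left_zero[OF tendsto_norm_zero[OF LIM_zero[OF lim]]] by simp
  then have lim0: "(\<lambda>n. suminf (\<lambda>k. T k n)) \<longlonglongrightarrow> suminf (\<lambda>k. 0 :: real)"
    using tannerys_theorem[of T "\<lambda>_. 0" sequentially "\<lambda>k. 2 * (B k * \<sigma> ^ k)"]
      summable_mult[OF summ[OF \<sigma>(1)], of 2] Tb
    by (auto simp: always_eventually case_prod_unfold)
  have sT: "summable (\<lambda>k. T k n)" for n
    by (rule summable_comparison_test'[OF summable_mult[OF summ[OF \<sigma>(1)], of 2]]) (rule Tb)
  have est: "dist (poly (f n) z) (F z) \<le> suminf (\<lambda>k. T k n)" if z: "z \<in> cball 0 \<rho>" for n z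
  proof -
    have "(\<lambda>k. coeff (f n) k * z ^ k) sums poly (f n) z"
      unfolding poly_altdef by (rule sums_finite) (auto simp: coeff_eq_0)
    from sums_diff[OF this F]
    have s: "(\<lambda>k. (coeff (f n) k - c k) * z ^ k) sums (poly (f n) z - F z)"
      by (simp add: algebra_simps)
    have le: "norm ((coeff (f n) k - c k) * z ^ k) \<le> T k n" for k
      unfolding T_def norm_mult norm_power using z \<sigma>
      by (intro mult_left_mono power_mono) auto
    have "norm (suminf (\<lambda>k. (coeff (f n) k - c k) * z ^ k)) \<le> suminf (\<lambda>k. T k n)"
      by (rule norm_suminf_le[OF le sT])
    then show ?thesis using s by (simp add: sums_iff dist_norm)
  qed
  show ?thesis
  proof (rule uniform_limitI)
    fix e :: real assume "e > 0"
    then have "\<forall>\<^sub>F n in sequentially. suminf (\<lambda>k. T k n) < e"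
      using order_tendstoD(2)[OF lim0, of e] by simp
    then show "\<forall>\<^sub>F n in sequentially. \<forall>z\<in>cball 0 \<rho>. dist (poly (f n) z) (F z) < e"
      by eventually_elim (use est le_less_trans in blast)
  qed
qed

section \<open>Counting real and non-real zeros of real polynomials\<close>

abbreviation cpoly :: "real poly \<Rightarrow> complex poly" where
  "cpoly \<equiv> map_poly complex_of_real"

lemma coeff_cpoly [simp]: "coeff (cpoly p) k = of_real (coeff p k)"
  by (simp add: coeff_map_poly)

lemma cpoly_eq_0_iff [simp]: "cpoly p = 0 \<longleftrightarrow> p = 0"
  by (simp add: poly_eq_iff)

lemma degree_cpoly [simp]: "degree (cpoly p) = degree p"
  by (rule degree_map_poly) simp

lemma cpoly_mult: "cpoly (p * q) = cpoly p * cpoly q"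
  by (rule poly_eqI) (simp add: coeff_mult)

lemma cpoly_power: "cpoly (p ^ n) = cpoly p ^ n"
  by (induction n) (simp_all add: cpoly_mult)

lemma poly_cpoly_of_real [simp]: "poly (cpoly p) (of_real x) = of_real (poly p x)"
  by (induction p) (simp_all add: map_poly_pCons)

lemma order_cpoly_of_real:
  assumes "p \<noteq> 0"
  shows "order (of_real x) (cpoly p) = order x p"
proof -
  obtain q where q: "p = [:- x, 1:] ^ order x p * q" "\<not> [:- x, 1:] dvd q"
    using order_decomp[OF assms] by blast
  have "poly q x \<noteq> 0" using q(2) by (simp add: poly_eq_0_iff_dvd)
  moreover have "cpoly p = [:- of_real x, 1:] ^ order x p * cpoly q"
    by (subst q(1)) (simp add: cpoly_mult cpoly_power map_poly_pCons)
  ultimately show ?thesis by (intro order_eqI) auto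
qed

lemma nonreal_zero_count_eq: "nonreal_zero_count p = nonreal_order_sum (cpoly p)"
  by (simp add: nonreal_zero_count_def nonreal_order_sum_def)

text \<open>As the size of a multiset, the count is additive under products through
  \<open>proots_mult\<close>.\<close>

lemma nonreal_order_sum_proots:
  assumes "p \<noteq> 0"
  shows "nonreal_order_sum p = size (filter_mset (\<lambda>z. Im z \<noteq> 0) (proots p))"
  using assms
  by (simp add: nonreal_order_sum_def size_multiset_overloaded_eq Collect_conj_eq)

lemma nonreal_zero_count_mult:
  assumes "p \<noteq> 0" "q \<noteq> 0"
  shows "nonreal_zero_count (p * q) = nonreal_zero_count p + nonreal_zero_count q"
  using assms by (simp add: nonreal_zero_count_eq nonreal_order_sum_proots cpoly_mult proots_mult)

lemma nonreal_zero_count_power: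
  assumes "p \<noteq> 0"
  shows "nonreal_zero_count (p ^ n) = n * nonreal_zero_count p"
  using assms
  by (induction n) (simp_all add: nonreal_zero_count_mult, simp add: nonreal_zero_count_def)

text \<open>Fundamental theorem of algebra. It turns the lower bounds on real zeros from Rolle's
  theorem into upper bounds on non-real ones.\<close>

lemma real_plus_nonreal_zero_count:
  assumes "p \<noteq> 0"
  shows "real_zero_count p + nonreal_zero_count p = degree p"
proof -
  have fin: "finite {z. poly (cpoly p) z = 0}" using assms by (simp add: poly_roots_finite)
  have "degree p = (\<Sum>z\<in>{z. poly (cpoly p) z = 0}. order z (cpoly p))"
    using assms size_proots_complex[of "cpoly p"] by (simp add: size_multiset_overloaded_eq)
  also have "{z. poly (cpoly p) z = 0} =
      {z. poly (cpoly p) z = 0 \<and> Im z = 0} \<union> {z. poly (cpoly p) z = 0 \<and> Im z \<noteq> 0}" by auto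
  also have "(\<Sum>z\<in>\<dots>. order z (cpoly p)) =
      (\<Sum>z\<in>{z. poly (cpoly p) z = 0 \<and> Im z = 0}. order z (cpoly p)) + nonreal_zero_count p"
    unfolding nonreal_zero_count_def
    by (rule sum.union_disjoint) (auto intro: finite_subset[OF _ fin])
  also have "{z. poly (cpoly p) z = 0 \<and> Im z = 0} = of_real ` {x. poly p x = 0}"
  proof (intro equalityI subsetI)
    fix z assume "z \<in> {z. poly (cpoly p) z = 0 \<and> Im z = 0}"
    moreover from this have "z = of_real (Re z)" by (simp add: complex_eq_iff)
    ultimately have "poly p (Re z) = 0"
      using poly_cpoly_of_real[of p "Re z"] by simp
    then show "z \<in> of_real ` {x. poly p x = 0}" using \<open>z = of_real (Re z)\<close> by blast
  qed auto
  also have "(\<Sum>z\<in>of_real ` {x. poly p x = 0}. order z (cpoly p)) = real_zero_count p"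
    unfolding real_zero_count_def
    by (subst sum.reindex) (auto simp: inj_on_def order_cpoly_of_real[OF assms])
  finally show ?thesis by simp
qed

text \<open>Meant for two maps that preserve the set of non-real numbers: \<open>inverse\<close> for
  reversal, and division by a nonzero real for rescaling.\<close>

lemma nonreal_order_sum_bij:
  assumes "bij_betw h {z. Im z \<noteq> 0} {z. Im z \<noteq> 0}" "p \<noteq> 0" "q \<noteq> 0"
    and "\<And>z. Im z \<noteq> 0 \<Longrightarrow> order (h z) q = order z p"
  shows "nonreal_order_sum q = nonreal_order_sum p"
proof -
  have root: "poly q (h z) = 0 \<longleftrightarrow> poly p z = 0" if "Im z \<noteq> 0" for z
    using assms(4)[OF that] assms(2,3) by (metis order_root)
  have "bij_betw h {z. poly p z = 0 \<and> Im z \<noteq> 0} {z. poly q z = 0 \<and> Im z \<noteq> 0}"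
  proof (rule bij_betw_subset[OF assms(1)])
    show "h ` {z. poly p z = 0 \<and> Im z \<noteq> 0} = {z. poly q z = 0 \<and> Im z \<noteq> 0}"
      using assms(1) root by (fastforce simp: bij_betw_def image_iff)
  qed auto
  then show ?thesis unfolding nonreal_order_sum_def
    by (subst sum.reindex_bij_betw[symmetric]) (auto simp: assms(4) intro!: sum.cong)
qed

text \<open>A zero z different from 0 moves to 1/z with the same order, as x - z reverses to -z (x -
  1/z). Reversal loses zeros at 0, but those are real.\<close>

lemma nonreal_zero_count_reflect_poly:
  assumes "p \<noteq> 0"
  shows "nonreal_zero_count (reflect_poly p) = nonreal_zero_count p"
proof -
  have c: "cpoly (reflect_poly p) = reflect_poly (cpoly p)"
    by (rule poly_eqI) (simp add: coeff_reflect_poly)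
  have "order (inverse z) (reflect_poly (cpoly p)) = order z (cpoly p)" if "Im z \<noteq> 0" for z
  proof -
    have z: "z \<noteq> 0" using that by auto
    obtain q where q: "cpoly p = [:- z, 1:] ^ order z (cpoly p) * q" "\<not> [:- z, 1:] dvd q"
      using order_decomp[of "cpoly p"] assms by auto
    have "poly q z \<noteq> 0" using q(2) by (simp add: poly_eq_0_iff_dvd)
    have lin: "reflect_poly [:- z, 1:] = smult (- z) [:- inverse z, 1:]"
      using z by (simp add: reflect_poly_pCons)
    have "reflect_poly (cpoly p) =
        [:- inverse z, 1:] ^ order z (cpoly p) * smult ((- z) ^ order z (cpoly p)) (reflect_poly q)"
      by (subst q(1)) (simp only: reflect_poly_mult reflect_poly_power lin smult_power
        mult_smult_left mult_smult_right)
    moreover have "poly (smult ((- z) ^ order z (cpoly p)) (reflect_poly q)) (inverse z) \<noteq> 0"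
      using z \<open>poly q z \<noteq> 0\<close> by (simp add: poly_reflect_poly_nz)
    ultimately show ?thesis by (rule order_eqI)
  qed
  moreover have "bij_betw inverse {z. Im z \<noteq> 0} {z. Im z \<noteq> 0}"
    by (rule bij_betwI[where g = inverse]) (auto simp: Im_divide complex_neq_0)
  ultimately show ?thesis
    using assms by (simp add: nonreal_zero_count_eq c nonreal_order_sum_bij)
qed

lemma nonreal_zero_count_scale:
  assumes "p \<noteq> 0" "c \<noteq> 0"
  shows "nonreal_zero_count (pcompose p [:0, c:]) = nonreal_zero_count p"
proof -
  define C where "C = complex_of_real c"
  have C: "C \<noteq> 0" using assms(2) by (simp add: C_def)
  have c: "cpoly (pcompose p [:0, c:]) = pcompose (cpoly p) [:0, C:]"
    by (rule poly_eqI) (simp add: coeff_pcompose_linear C_def)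
  have nz: "pcompose (cpoly p) [:0, C:] \<noteq> 0"
    using assms C by (simp add: pcompose_eq_0_iff)
  have "order (z / C) (pcompose (cpoly p) [:0, C:]) = order z (cpoly p)" for z
  proof -
    obtain q where q: "cpoly p = [:- z, 1:] ^ order z (cpoly p) * q" "\<not> [:- z, 1:] dvd q"
      using order_decomp[of "cpoly p"] assms by auto
    have "poly q z \<noteq> 0" using q(2) by (simp add: poly_eq_0_iff_dvd)
    have pw: "pcompose (r ^ k) s = pcompose r s ^ k" for r s :: "complex poly" and k
      by (induction k) (simp_all add: pcompose_mult pcompose_1)
    have lin: "pcompose [:- z, 1:] [:0, C:] = smult C [:- (z / C), 1:]"
      using C by (simp add: pcompose_pCons)
    have "pcompose (cpoly p) [:0, C:] = [:- (z / C), 1:] ^ order z (cpoly p) *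
        smult (C ^ order z (cpoly p)) (pcompose q [:0, C:])"
      by (subst q(1)) (simp only: pcompose_mult pw lin smult_power
        mult_smult_left mult_smult_right)
    moreover have "poly (smult (C ^ order z (cpoly p)) (pcompose q [:0, C:])) (z / C) \<noteq> 0"
      using C \<open>poly q z \<noteq> 0\<close> by (simp add: poly_pcompose)
    ultimately show ?thesis by (rule order_eqI)
  qed
  moreover have "bij_betw (\<lambda>z. z / C) {z. Im z \<noteq> 0} {z. Im z \<noteq> 0}"
    using C assms(2) by (intro bij_betwI[where g = "\<lambda>z. z * C"]) (auto simp: C_def)
  ultimately show ?thesis
    using assms(1) nz
    unfolding nonreal_zero_count_eq c by (intro nonreal_order_sum_bij) auto
qed

section \<open>Derivatives\<close>

text \<open>Requiring \<open>c x\<close> to precede every later element of \<open>X\<close> gives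
  injectivity and interlacing without listing the zeros in order.\<close>

lemma rolle_between_roots:
  fixes p :: "real poly" and X :: "real set"
  assumes "finite X" "X \<subseteq> {x. poly p x = 0}"
  obtains c where "\<And>x. x \<in> X - {Max X} \<Longrightarrow> x < c x \<and> poly (pderiv p) (c x) = 0"
    and "\<And>x y. x \<in> X - {Max X} \<Longrightarrow> y \<in> X \<Longrightarrow> x < y \<Longrightarrow> c x < y"
proof -
  have "\<exists>c>x. poly (pderiv p) c = 0 \<and> (\<forall>y\<in>X. x < y \<longrightarrow> c < y)" if x: "x \<in> X - {Max X}" for x
  proof -
    define Y where "Y = {y\<in>X. x < y}"
    have "x < Max X" using x assms(1) Max_ge[of X x] by (auto simp: less_le)
    moreover have "Max X \<in> X" using x assms(1) by (intro Max_in) auto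
    ultimately have Y: "finite Y" "Y \<noteq> {}" using assms(1) by (auto simp: Y_def)
    then have m: "Min Y \<in> X" "x < Min Y" using Min_in[OF Y] by (auto simp: Y_def)
    then have "poly p x = 0" "poly p (Min Y) = 0" using assms(2) x by auto
    then obtain c where c: "x < c" "c < Min Y" "poly (pderiv p) c = 0"
      using poly_MVT[OF m(2), of p] m(2) by auto
    have "c < y" if "y \<in> X" "x < y" for y
      using c(2) Min_le[OF Y(1), of y] that by (simp add: Y_def)
    then show ?thesis using c by blast
  qed
  then have "\<exists>c. \<forall>x\<in>X - {Max X}. c x > x \<and> poly (pderiv p) (c x) = 0 \<and> (\<forall>y\<in>X. x < y \<longrightarrow> c x < y)"
    by (intro bchoice) blast
  then show ?thesis using that by blast
qed

text \<open>At each zero of \<open>p\<close> the derivative loses exactly one unit of multiplicity.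
  The count is stated additively to avoid truncated subtraction; Rolle's points are distinct zeros
  outside \<open>X\<close>, none if \<open>X\<close> is empty.\<close>

lemma rolle_count:
  fixes p :: "real poly"
  assumes "degree p > 0"
  defines "X \<equiv> {x. poly p x = 0}" and "Y \<equiv> {x. poly (pderiv p) x = 0}"
  obtains c where
    "\<And>x. x \<in> X - {Max X} \<Longrightarrow> x < c x"
    "\<And>x y. x \<in> X - {Max X} \<Longrightarrow> y \<in> X \<Longrightarrow> x < y \<Longrightarrow> c x < y"
    "c ` (X - {Max X}) \<subseteq> Y - X"
    "real_zero_count (pderiv p) + card X = real_zero_count p +
       (\<Sum>y\<in>Y - X. order y (pderiv p))"
    "card (c ` (X - {Max X})) = card X - 1"
proof -
  have p0: "p \<noteq> 0" "pderiv p \<noteq> 0" using assms(1) by (auto simp: pderiv_eq_0_iff)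
  have fin: "finite X" "finite Y" using p0 poly_roots_finite by (auto simp: X_def Y_def)
  obtain c where c: "\<And>x. x \<in> X - {Max X} \<Longrightarrow> x < c x \<and> poly (pderiv p) (c x) = 0"
    "\<And>x y. x \<in> X - {Max X} \<Longrightarrow> y \<in> X \<Longrightarrow> x < y \<Longrightarrow> c x < y"
    using rolle_between_roots[OF fin(1), of p] by (auto simp: X_def)
  have inj: "inj_on c (X - {Max X})"
  proof (rule inj_onI)
    fix x y assume h: "x \<in> X - {Max X}" "y \<in> X - {Max X}" "c x = c y"
    show "x = y"
    proof (rule linorder_cases[of x y])
      assume "x < y" then show ?thesis using c(1)[OF h(2)] c(2)[of x y] h by auto
    next
      assume "y < x" then show ?thesis using c(1)[OF h(1)] c(2)[of y x] h by auto
    qed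
  qed
  have sub: "c ` (X - {Max X}) \<subseteq> Y - X"
  proof
    fix y assume "y \<in> c ` (X - {Max X})"
    then obtain x where x: "x \<in> X - {Max X}" "y = c x" by blast
    then have "y \<notin> X" using c(1)[of x] c(2)[of x y] by blast
    then show "y \<in> Y - X" using c(1)[OF x(1)] x(2) by (simp add: Y_def)
  qed
  have ord: "order x p = Suc (order x (pderiv p))" if "x \<in> X" for x
    using that p0(1) by (intro order_pderiv) (auto simp: X_def)
  have "real_zero_count (pderiv p) = (\<Sum>y\<in>X \<union> Y. order y (pderiv p))"
    unfolding real_zero_count_def Y_def[symmetric]
    by (rule sum.mono_neutral_left) (use fin in \<open>auto simp: Y_def order_0I\<close>)
  also have "X \<union> Y = X \<union> (Y - X)" by blast
  also have "(\<Sum>y\<in>X \<union> (Y - X). order y (pderiv p)) =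
      (\<Sum>y\<in>X. order y (pderiv p)) + (\<Sum>y\<in>Y - X. order y (pderiv p))"
    by (rule sum.union_disjoint) (use fin in auto)
  finally have "real_zero_count (pderiv p) + card X = (\<Sum>y\<in>X. Suc (order y (pderiv p))) +
      (\<Sum>y\<in>Y - X. order y (pderiv p))"
    by (simp add: sum_Suc)
  also have "(\<Sum>y\<in>X. Suc (order y (pderiv p))) = real_zero_count p"
    unfolding real_zero_count_def X_def[symmetric] using ord by simp
  finally have cnt: "real_zero_count (pderiv p) + card X = real_zero_count p +
      (\<Sum>y\<in>Y - X. order y (pderiv p))" .
  have "card (c ` (X - {Max X})) = card (X - {Max X})" by (rule card_image[OF inj])
  also have "\<dots> = card X - 1"
    using fin(1) by (cases "X = {}") (simp_all add: card_Diff_singleton)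
  finally show ?thesis using that[of c] c sub cnt by blast
qed

text \<open>Differentiation lowers the degree by one and the number of real zeros, with
  multiplicity, by at most one.\<close>

lemma nonreal_zero_count_pderiv_le:
  "nonreal_zero_count (pderiv p) \<le> nonreal_zero_count p"
proof (cases "degree p = 0")
  case True
  \<comment> \<open>The zero polynomial vanishes at infinitely many non-real points, so its count is
    the default value 0 of a sum over an infinite set.\<close>
  then have "pderiv p = 0" by (simp add: pderiv_eq_0_iff)
  moreover have "infinite {z. Im z \<noteq> 0}"
  proof
    assume "finite {z. Im z \<noteq> 0}"
    then have "finite (range (\<lambda>n. Complex (real n) 1))" by (rule finite_subset[rotated]) auto
    moreover have "inj (\<lambda>n. Complex (real n) 1)" by (auto simp: inj_def)
    ultimately show False using finite_imageD by blast
  qed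
  ultimately show ?thesis by (simp add: nonreal_zero_count_def)
next
  case False
  then have d: "degree p > 0" by simp
  then have p0: "p \<noteq> 0" "pderiv p \<noteq> 0" by (auto simp: pderiv_eq_0_iff)
  define X where "X = {x. poly p x = 0}"
  define Y where "Y = {x. poly (pderiv p) x = 0}"
  obtain c where c: "c ` (X - {Max X}) \<subseteq> Y - X"
    "real_zero_count (pderiv p) + card X = real_zero_count p + (\<Sum>y\<in>Y - X. order y (pderiv p))"
    "card (c ` (X - {Max X})) = card X - 1"
    using rolle_count[OF d] unfolding X_def Y_def by metis
  have finY: "finite Y" using p0 poly_roots_finite by (auto simp: Y_def)
  have "card (c ` (X - {Max X})) \<le> card (Y - X)"
    using c(1) finY by (intro card_mono) auto
  also have "\<dots> \<le> (\<Sum>y\<in>Y - X. order y (pderiv p))"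
  proof -
    have "(\<Sum>y\<in>Y - X. 1) \<le> (\<Sum>y\<in>Y - X. order y (pderiv p))"
      using p0(2) by (intro sum_mono) (auto simp: Y_def order_root Suc_le_eq)
    then show ?thesis by simp
  qed
  finally have "real_zero_count p \<le> real_zero_count (pderiv p) + 1" using c(2,3) by linarith
  then show ?thesis
    using real_plus_nonreal_zero_count[OF p0(1)] real_plus_nonreal_zero_count[OF p0(2)] d
    by (simp add: degree_pderiv)
qed

lemma nonreal_zero_count_higher_pderiv_le:
  "nonreal_zero_count ((pderiv ^^ n) p) \<le> nonreal_zero_count p"
  by (induction n) (auto intro: order_trans[OF nonreal_zero_count_pderiv_le])

text \<open>Equality leaves no slack in Rolle's count: the zeros of the derivative outside
  \<open>X\<close> are exactly the \<open>card X - 1\<close> Rolle points, each simple. If no zero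
  is shared, these are all its real zeros, one in each gap of \<open>X\<close>.\<close>

lemma pderiv_same_nonreal_zero_count:
  fixes p :: "real poly"
  assumes d: "degree p > 0"
    and same: "nonreal_zero_count (pderiv p) = nonreal_zero_count p"
  shows "poly (pderiv p) y = 0 \<Longrightarrow> poly p y \<noteq> 0 \<Longrightarrow> order y (pderiv p) = 1"
    and "(\<And>y. poly p y = 0 \<Longrightarrow> poly (pderiv p) y \<noteq> 0) \<Longrightarrow>
           interlaces (real_zeros p) (real_zeros (pderiv p))"
proof -
  have p0: "p \<noteq> 0" "pderiv p \<noteq> 0" using d by (auto simp: pderiv_eq_0_iff)
  define X where "X = {x. poly p x = 0}"
  define Y where "Y = {x. poly (pderiv p) x = 0}"
  obtain c where c: "\<And>x. x \<in> X - {Max X} \<Longrightarrow> x < c x"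
    "\<And>x y. x \<in> X - {Max X} \<Longrightarrow> y \<in> X \<Longrightarrow> x < y \<Longrightarrow> c x < y"
    "c ` (X - {Max X}) \<subseteq> Y - X"
    "real_zero_count (pderiv p) + card X = real_zero_count p + (\<Sum>y\<in>Y - X. order y (pderiv p))"
    "card (c ` (X - {Max X})) = card X - 1"
    using rolle_count[OF d] unfolding X_def Y_def by metis
  have fin: "finite X" "finite Y" using p0 poly_roots_finite by (auto simp: X_def Y_def)
  have cnt: "real_zero_count p = Suc (real_zero_count (pderiv p))"
    using real_plus_nonreal_zero_count[OF p0(1)] real_plus_nonreal_zero_count[OF p0(2)] d same
    by (simp add: degree_pderiv)
  then have X0: "X \<noteq> {}" by (intro notI) (simp add: real_zero_count_def X_def)
  then have cX: "card X > 0" using fin by (simp add: card_gt_0_iff)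
  have ge1: "1 \<le> order y (pderiv p)" if "y \<in> Y - X" for y
    using p0(2) that by (auto simp: Y_def order_root Suc_le_eq)
  have sum: "(\<Sum>y\<in>Y - X. order y (pderiv p)) = card X - 1" using c(4) cnt by linarith
  have le: "card (Y - X) \<le> card X - 1"
    using sum_mono[of "Y - X" "\<lambda>_. 1" "\<lambda>y. order y (pderiv p)"] ge1 sum by simp
  have img: "c ` (X - {Max X}) = Y - X"
    using c(3,5) le fin(2) by (intro card_seteq) auto
  {
    assume y: "poly (pderiv p) y = 0" "poly p y \<noteq> 0"
    then have y': "y \<in> Y - X" by (auto simp: X_def Y_def)
    show "order y (pderiv p) = 1"
    proof (rule ccontr)
      assume "order y (pderiv p) \<noteq> 1"
      then have "1 < order y (pderiv p)" using ge1[OF y'] by simp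
      then have "(\<Sum>y\<in>Y - X. 1) < (\<Sum>y\<in>Y - X. order y (pderiv p))"
        using ge1 y' fin by (intro sum_strict_mono_ex1) auto
      then show False using sum c(5) img by simp
    qed
  next
    assume "\<And>y. poly p y = 0 \<Longrightarrow> poly (pderiv p) y \<noteq> 0"
    then have "Y - X = Y" by (auto simp: X_def Y_def)
    then have img: "c ` (X - {Max X}) = Y" using img by simp
    have "interlaces X Y"
      unfolding interlaces_def
    proof (intro conjI impI ballI)
      assume "Y \<noteq> {}"
      then have "Min Y \<in> c ` (X - {Max X})" using Min_in[OF fin(2)] img by simp
      then obtain x where x: "x \<in> X - {Max X}" "Min Y = c x" by blast
      have "Min X \<le> x" using x fin by simp
      then show "Min X < Min Y" using c(1)[OF x(1)] x(2) by simp
    next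
      fix a b assume ab: "a \<in> X" "b \<in> X" "a < b \<and> \<not> (\<exists>c\<in>X. a < c \<and> c < b)"
      then have "a \<in> X - {Max X}" using Max_ge[OF fin(1) ab(2)] by auto
      then show "\<exists>v\<in>Y. a < v \<and> v < b" using c(1,2) ab img by blast
    next
      fix a b assume ab: "a \<in> Y" "b \<in> Y" "a < b \<and> \<not> (\<exists>c\<in>Y. a < c \<and> c < b)"
      then obtain x y where xy: "x \<in> X - {Max X}" "y \<in> X - {Max X}" "a = c x" "b = c y"
        using img by blast
      have "x < y"
      proof (rule ccontr)
        assume "\<not> x < y"
        then have "x = y \<or> y < x" by auto
        then show False using ab xy c(1)[OF xy(1)] c(2)[of y x] by auto
      qed
      then show "\<exists>u\<in>X. a < u \<and> u < b" using xy c(1)[OF xy(2)] c(2)[of x y] by auto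
    qed (use X0 in auto)
    then show "interlaces (real_zeros p) (real_zeros (pderiv p))"
      by (simp add: real_zeros_def X_def Y_def)
  }
qed

section \<open>Multipliers\<close>

text \<open>Bounded degree turns coefficientwise into locally uniform convergence. The limit may
  have smaller degree, which semicontinuity tolerates.\<close>

lemma nonreal_zero_count_limit_le:
  fixes f :: "nat \<Rightarrow> real poly"
  assumes p: "p \<noteq> 0" and f: "\<And>n. f n \<noteq> 0" "\<And>n. degree (f n) \<le> d"
    and lim: "\<And>k. (\<lambda>n. coeff (f n) k) \<longlonglongrightarrow> coeff p k"
    and count: "\<And>n. nonreal_zero_count (f n) \<le> N"
  shows "nonreal_zero_count p \<le> N"
proof -
  have "\<exists>b. \<forall>n. norm (coeff (f n) k) \<le> b" for k
    using convergent_imp_Bseq[OF convergentI[OF lim[of k]]] by (auto simp: Bseq_def)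
  then obtain b where b: "\<And>k n. norm (coeff (f n) k) \<le> b k" by metis
  define B where "B k = (if k \<le> d then b k else 0)" for k
  have "uniform_limit (cball 0 \<rho>) (\<lambda>n. poly (cpoly (f n))) (\<lambda>z. poly (cpoly p) z * 1) sequentially" for \<rho>
  proof (rule uniform_limit_poly_dominated)
    show "norm (coeff (cpoly (f n)) k) \<le> B k" for n k
      using b[of n k] le_less_trans[OF f(2), of k n] by (auto simp: B_def coeff_eq_0 not_le)
    show "summable (\<lambda>k. B k * \<rho> ^ k)" for \<rho>
      by (rule summable_finite[of "{..d}"]) (auto simp: B_def)
    show "(\<lambda>n. coeff (cpoly (f n)) k) \<longlonglongrightarrow> coeff (cpoly p) k" for k
      using tendsto_of_real[OF lim] by simp
    show "(\<lambda>k. coeff (cpoly p) k * z ^ k) sums (poly (cpoly p) z * 1)" for z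
      unfolding poly_altdef mult_1_right by (rule sums_finite) (auto simp: coeff_eq_0)
  qed
  then have "\<forall>\<^sub>F n in sequentially. nonreal_order_sum (cpoly p) \<le> nonreal_order_sum (cpoly (f n))"
    using p f(1) by (intro nonreal_order_sum_le_eventually[where E = "\<lambda>_. 1"]) auto
  then obtain n where "nonreal_order_sum (cpoly p) \<le> nonreal_order_sum (cpoly (f n))"
    using eventually_happens'[OF sequentially_bot] by blast
  then show ?thesis using count[of n] by (simp add: nonreal_zero_count_eq)
qed

lemma nonreal_zero_count_monom [simp]:
  "c \<noteq> 0 \<Longrightarrow> nonreal_zero_count (monom c n) = 0"
proof -
  assume "c \<noteq> 0"
  have "cpoly (monom c n) = monom (of_real c) n" by (rule poly_eqI) auto
  then have "{z. poly (cpoly (monom c n)) z = 0 \<and> Im z \<noteq> 0} = {}"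
    using \<open>c \<noteq> 0\<close> by (auto simp: poly_monom)
  then show ?thesis unfolding nonreal_zero_count_def by (simp only: sum.empty)
qed

lemma nonreal_zero_count_linear [simp]: "nonreal_zero_count [:a, 1:] = 0"
proof -
  have "{z. poly (cpoly [:a, 1:]) z = 0 \<and> Im z \<noteq> 0} = {}"
    by (auto simp: map_poly_pCons complex_eq_iff)
  then show ?thesis unfolding nonreal_zero_count_def by (simp only: sum.empty)
qed

lemma nonreal_zero_count_smult [simp]:
  assumes "c \<noteq> 0" "p \<noteq> 0"
  shows "nonreal_zero_count (smult c p) = nonreal_zero_count p"
  using nonreal_zero_count_mult[of "[:c:]" p] nonreal_zero_count_monom[of c 0] assms
  by (simp add: monom_0)

text \<open>Needed both for the coefficients of (1 - t^2/(4m))^m and for the factor n!/((n-k)! n^k)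
  in the rescaled q_n.\<close>

lemma tendsto_binomial_over_power:
  "(\<lambda>n. real (n choose k) / real n ^ k) \<longlonglongrightarrow> 1 / fact k"
proof -
  have "(\<lambda>n. (\<Prod>i = 0..<k. 1 - real i * inverse (real n)) / fact k) \<longlonglongrightarrow> (\<Prod>i = 0..<k. 1 - real i * 0) / fact k"
    by (intro tendsto_intros lim_inverse_n) auto
  moreover have "\<forall>\<^sub>F n in sequentially.
      (\<Prod>i = 0..<k. 1 - real i * inverse (real n)) / fact k = real (n choose k) / real n ^ k"
    using eventually_gt_at_top[of 0]
  proof eventually_elim
    case (elim n)
    have "real (n choose k) / real n ^ k = (\<Prod>i = 0..<k. real n - real i) / (\<Prod>i = 0..<k. real n) / fact k"
      by (simp add: binomial_gbinomial gbinomial_prod_rev)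
    also have "(\<Prod>i = 0..<k. real n - real i) / (\<Prod>i = 0..<k. real n) = (\<Prod>i = 0..<k. 1 - real i * inverse (real n))"
      unfolding prod_dividef[symmetric] using elim by (intro prod.cong) (auto simp: field_simps)
    finally show ?case by simp
  qed
  ultimately show ?thesis by (simp add: Lim_transform_eventually)
qed

lemma tendsto_pochhammer_over_power:
  "(\<lambda>n. pochhammer (real (Suc n)) k / real n ^ k) \<longlonglongrightarrow> 1"
proof -
  have "(\<lambda>n. \<Prod>i = 0..<k. 1 + real (Suc i) * inverse (real n)) \<longlonglongrightarrow> (\<Prod>i = 0..<k. 1 + real (Suc i) * 0)"
    by (intro tendsto_intros lim_inverse_n)
  moreover have "\<forall>\<^sub>F n in sequentially.
      (\<Prod>i = 0..<k. 1 + real (Suc i) * inverse (real n)) = pochhammer (real (Suc n)) k / real n ^ k"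
    using eventually_gt_at_top[of 0]
  proof eventually_elim
    case (elim n)
    have "pochhammer (real (Suc n)) k / real n ^ k =
        (\<Prod>i = 0..<k. real (Suc n) + real i) / (\<Prod>i = 0..<k. real n)"
      by (simp add: pochhammer_prod)
    also have "\<dots> = (\<Prod>i = 0..<k. 1 + real (Suc i) * inverse (real n))"
      unfolding prod_dividef[symmetric] using elim by (intro prod.cong) (auto simp: field_simps)
    finally show ?case by simp
  qed
  ultimately show ?thesis by (simp add: Lim_transform_eventually)
qed

text \<open>The Pochhammer factor is what n derivatives put in front of the coefficient of
  x^(j+n).\<close>

lemma pochhammer_Suc_fact: "pochhammer (real (Suc j)) n * fact j = fact (j + n)"
  using pochhammer_product'[of "1::real" j n] by (simp add: pochhammer_fact[symmetric] mult.commute)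

definition borel_poly :: "real poly \<Rightarrow> real poly" where
  "borel_poly p = (\<Sum>j\<le>degree p. monom (coeff p j / fact j) j)"

lemma coeff_borel_poly [simp]: "coeff (borel_poly p) j = coeff p j / fact j"
  by (auto simp: borel_poly_def coeff_sum coeff_eq_0 not_le if_distrib
    cong: if_cong)

text \<open>The multiplier sequence $1/j!$ is the limit of $(M+j)!/(M!\,j!\,M^j)$, and the latter comes from
  differentiating $x^M p(x)$ exactly $M$ times and rescaling the variable.\<close>

lemma nonreal_zero_count_borel_poly_le:
  assumes p: "p \<noteq> 0"
  shows "nonreal_zero_count (borel_poly p) \<le> nonreal_zero_count p"
proof (rule nonreal_zero_count_limit_le)
  \<comment> \<open>Here M = \<open>Suc n\<close>, so that the scaling factor 1/M is
    nonzero.\<close>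
  define f where "f n = smult (1 / fact (Suc n))
    (pcompose ((pderiv ^^ Suc n) (monom 1 (Suc n) * p)) [:0, 1 / real (Suc n):])" for n
  have coeff_f: "coeff (f n) j = coeff p j * (pochhammer (real (Suc (Suc n))) j / real (Suc n) ^ j) / fact j" for n j
  proof -
    \<comment> \<open>Both sides are (j + M)!. This trades a product of M factors for one of j
      factors, whose limit is known.\<close>
    have "pochhammer (real (Suc j)) (Suc n) * fact j = pochhammer (real (Suc (Suc n))) j * fact (Suc n)"
      unfolding pochhammer_Suc_fact by (simp add: add.commute)
    then have "pochhammer (real (Suc j)) (Suc n) / fact (Suc n) = pochhammer (real (Suc (Suc n))) j / fact j"
      by (simp add: divide_simps mult.commute del: fact_Suc of_nat_Suc)
    moreover have "coeff (f n) j = (pochhammer (real (Suc j)) (Suc n) / fact (Suc n)) * coeff p j / real (Suc n) ^ j"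
      unfolding f_def coeff_smult coeff_pcompose_linear coeff_higher_pderiv
      by (simp add: coeff_monom_mult power_one_over divide_simps del: fact_Suc of_nat_Suc funpow.simps)
    ultimately show ?thesis by (simp add: mult_ac del: fact_Suc of_nat_Suc)
  qed
  show "(\<lambda>n. coeff (f n) j) \<longlonglongrightarrow> coeff (borel_poly p) j" for j
  proof -
    have "(\<lambda>n. coeff (f n) j) \<longlonglongrightarrow> coeff p j * 1 / fact j"
      unfolding coeff_f
      by (intro tendsto_divide tendsto_mult tendsto_const
          LIMSEQ_Suc[OF tendsto_pochhammer_over_power]) auto
    then show ?thesis by simp
  qed
  have nz: "pochhammer (real (Suc n)) j \<noteq> 0" for n j
    using pochhammer_pos[of "real (Suc n)" j] by simp
  have "coeff (f n) (degree p) \<noteq> 0" for n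
    unfolding coeff_f using p nz[of "Suc n" "degree p"] by (simp del: of_nat_Suc)
  then show fn: "f n \<noteq> 0" for n by (metis coeff_0)
  show "degree (f n) \<le> degree p" for n
    by (rule degree_le) (simp add: coeff_f coeff_eq_0)
  have "coeff (borel_poly p) (degree p) \<noteq> 0" using p by simp
  then show "borel_poly p \<noteq> 0" by force
  show "nonreal_zero_count (f n) \<le> nonreal_zero_count p" for n
  proof -
    define g where "g = (pderiv ^^ Suc n) (monom 1 (Suc n) * p)"
    have "g \<noteq> 0" using fn[of n] unfolding f_def g_def[symmetric] by auto
    moreover from this have "pcompose g [:0, 1 / real (Suc n):] \<noteq> 0"
      by (simp add: pcompose_eq_0_iff del: of_nat_Suc)
    ultimately have "nonreal_zero_count (f n) = nonreal_zero_count g"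
      unfolding f_def g_def[symmetric]
      by (subst nonreal_zero_count_smult) (simp_all add: nonreal_zero_count_scale del: of_nat_Suc)
    \<comment> \<open>The only inequality comes from Rolle's theorem: rescaling preserves the count,
      and x^M adds only the real zero 0.\<close>
    also have "\<dots> \<le> nonreal_zero_count (monom 1 (Suc n) * p)"
      unfolding g_def by (rule nonreal_zero_count_higher_pderiv_le)
    also have "\<dots> = nonreal_zero_count p"
      using p by (simp add: nonreal_zero_count_mult)
    finally show ?thesis .
  qed
qed

section \<open>The polynomials $q_n$\<close>

lemma pderiv_hermite_Suc: "pderiv (hermite (Suc n)) = smult (2 * real (Suc n)) (hermite n)"
proof (induction n rule: hermite.induct)
  case (3 n)
  have "pderiv (hermite (Suc (Suc (Suc n)))) =
      smult 2 (hermite (Suc (Suc n))) + [:0, 2:] * pderiv (hermite (Suc (Suc n)))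
       - smult (2 * (real (Suc n) + 1)) (pderiv (hermite (Suc n)))"
    by (subst hermite.simps(3)) (simp add: pderiv_diff pderiv_mult pderiv_smult pderiv_pCons del: hermite.simps(3))
  also have "\<dots> = smult 2 (hermite (Suc (Suc n))) + smult (2 * real (Suc (Suc n)))
     ([:0, 2:] * hermite (Suc n) - smult (2 * (real n + 1)) (hermite n))"
    unfolding 3 poly_eq_poly_eq_iff[symmetric]
    by (rule ext) (simp add: algebra_simps del: hermite.simps(3))
  also have "[:0, 2:] * hermite (Suc n) - smult (2 * (real n + 1)) (hermite n) = hermite (Suc (Suc n))"
    by simp
  also have "smult 2 (hermite (Suc (Suc n))) + smult (2 * real (Suc (Suc n))) (hermite (Suc (Suc n)))
     = smult (2 * real (Suc (Suc (Suc n)))) (hermite (Suc (Suc n)))"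
    unfolding smult_add_left[symmetric] by (simp add: algebra_simps del: hermite.simps(3))
  finally show ?case .
qed (simp_all add: pderiv_pCons pderiv_diff pderiv_smult)

text \<open>The normalisation by 2^n n! removes the factor 2n from the derivative of H_n; the value
  0 at negative indices lets the rule pass termwise to q_n.\<close>

lemma pderiv_hat_hermite: "pderiv (hat_hermite n) = hat_hermite (n - 1)"
proof (cases "n \<le> 0")
  case True
  then show ?thesis by (auto simp: hat_hermite_def pderiv_smult)
next
  case False
  then obtain m where n: "n = int (Suc m)"
    by (metis not_le gr0_implies_Suc zero_less_imp_eq_int)
  have c: "2 * real (Suc m) / (2 ^ Suc m * fact (Suc m)) = 1 / (2 ^ m * fact m)"
    by (simp add: fact_Suc field_simps del: of_nat_Suc)
  have m: "n - 1 = int m" by (simp add: n)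
  have "pderiv (hat_hermite n) = smult (2 * real (Suc m) / (2 ^ Suc m * fact (Suc m))) (hermite m)"
    by (simp add: n hat_hermite_def pderiv_smult pderiv_hermite_Suc nat_add_distrib
        del: hermite.simps fact_Suc of_nat_Suc power_Suc)
  then show ?thesis unfolding c m by (simp add: hat_hermite_def)
qed

text \<open>Coefficientwise this is h' = (y - t/2) h for the generating function h(t) = e^{yt -
  t^2/4}.\<close>

lemma poly_hat_hermite_rec:
  "real (Suc (Suc n)) * poly (hat_hermite (int (Suc (Suc n)))) y =
    y * poly (hat_hermite (int (Suc n))) y - poly (hat_hermite (int n)) y / 2"
  by (simp add: hat_hermite_def nat_add_distrib divide_simps del: of_nat_Suc) (simp add: algebra_simps)

text \<open>These are the Taylor coefficients of e^{-t^2/4}; at y = 0 the recurrence links only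
  indices of equal parity.\<close>

lemma poly_hat_hermite_0:
  "poly (hat_hermite (int (2 * i))) 0 = (- 1 / 4) ^ i / fact i"
  "poly (hat_hermite (int (2 * i + 1))) 0 = 0"
proof (induction i)
  case (Suc i)
  {
    case 1
    have "4 * real (Suc i) * poly (hat_hermite (int (2 * Suc i))) 0 = - poly (hat_hermite (int (2 * i))) 0"
      using poly_hat_hermite_rec[of "2 * i" 0] by (simp add: algebra_simps)
    then have "poly (hat_hermite (int (2 * Suc i))) 0 = - poly (hat_hermite (int (2 * i))) 0 / (4 * real (Suc i))"
      by (simp add: field_simps del: of_nat_Suc)
    then show ?case unfolding Suc(1) by (simp add: mult_ac del: of_nat_Suc)
  next
    case 2
    have e: "2 * Suc i + 1 = Suc (Suc (2 * i + 1))" by simp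
    show ?case using poly_hat_hermite_rec[of "2 * i + 1" 0] Suc(2)
      unfolding e by (simp del: of_nat_Suc)
  }
qed (simp_all add: hat_hermite_def)

lemma pderiv_qpoly: "pderiv (qpoly \<gamma> K (Suc n)) = qpoly \<gamma> K n"
  by (simp add: qpoly_def pderiv_smult pderiv_hat_hermite higher_pderiv_sum[of 1, simplified] algebra_simps)

lemma qpoly_0: "\<gamma> 0 = 1 \<Longrightarrow> qpoly \<gamma> K 0 = 1"
  unfolding qpoly_def
  by (subst sum.remove[of _ 0]) (auto simp: hat_hermite_def intro!: sum.neutral)

text \<open>Taylor expansion at 0: the i-th derivative of q_n is q_{n-i}, and q_0 = 1 ends the
  descent. Hence the numbers q_k(0) determine every q_n.\<close>

lemma coeff_qpoly:
  assumes "\<gamma> 0 = 1"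
  shows "coeff (qpoly \<gamma> K n) i = (if i \<le> n then poly (qpoly \<gamma> K (n - i)) 0 / fact i else 0)"
proof (induction i arbitrary: n)
  case 0
  then show ?case by (simp add: poly_0_coeff_0)
next
  case (Suc i)
  show ?case
  proof (cases n)
    case 0
    then show ?thesis by (simp add: qpoly_0[where \<gamma> = \<gamma>, OF assms] coeff_1)
  next
    case (Suc m)
    have "real (Suc i) * coeff (qpoly \<gamma> K n) (Suc i) = coeff (qpoly \<gamma> K m) i"
      using pderiv_qpoly[of \<gamma> K m] coeff_pderiv[of "qpoly \<gamma> K n" i] by (simp add: Suc)
    then have "coeff (qpoly \<gamma> K n) (Suc i) = coeff (qpoly \<gamma> K m) i / real (Suc i)"
      by (simp add: field_simps del: of_nat_Suc)
    then show ?thesis using Suc.IH[of m] by (simp add: Suc mult.commute del: of_nat_Suc)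
  qed
qed

lemma degree_qpoly:
  assumes "\<gamma> 0 = 1"
  shows "degree (qpoly \<gamma> K n) = n"
proof (rule antisym)
  show "degree (qpoly \<gamma> K n) \<le> n" by (rule degree_le) (simp add: coeff_qpoly[where \<gamma> = \<gamma>] assms)
  have "coeff (qpoly \<gamma> K n) n \<noteq> 0" by (simp add: coeff_qpoly[where \<gamma> = \<gamma>] assms qpoly_0)
  then show "n \<le> degree (qpoly \<gamma> K n)" by (rule le_degree)
qed

lemma qpoly_neq_0: "\<gamma> 0 = 1 \<Longrightarrow> qpoly \<gamma> K n \<noteq> 0"
  by (metis coeff_0 coeff_qpoly diff_self_eq_0 divide_eq_0_iff fact_nonzero order_refl poly_1 qpoly_0 zero_neq_one)

section \<open>P, its reversal Q, and q_n as a Cauchy product\<close>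

definition Qpoly :: "(nat \<Rightarrow> real) \<Rightarrow> nat \<Rightarrow> real poly" where
  "Qpoly \<gamma> K = (\<Sum>j = 0..K. monom (\<gamma> j) j)"

lemma coeff_Qpoly: "coeff (Qpoly \<gamma> K) j = (if j \<le> K then \<gamma> j else 0)"
  by (auto simp: Qpoly_def coeff_sum)

lemma coeff_Ppoly: "coeff (Ppoly \<gamma> K) i = (if i \<le> K then \<gamma> (K - i) else 0)"
proof -
  have "coeff (Ppoly \<gamma> K) i = (\<Sum>j = 0..K. if K - j = i then \<gamma> j else 0)"
    by (simp add: Ppoly_def coeff_sum)
  also have "\<dots> = (\<Sum>j = 0..K. if j = K - i then if i \<le> K then \<gamma> (K - i) else 0 else 0)"
    by (rule sum.cong) auto
  also have "\<dots> = (if i \<le> K then \<gamma> (K - i) else 0)" by (simp only: sum.delta finite_atLeastAtMost) auto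
  finally show ?thesis .
qed

lemma degree_Qpoly: "\<gamma> K \<noteq> 0 \<Longrightarrow> degree (Qpoly \<gamma> K) = K"
  by (intro antisym degree_le le_degree) (auto simp: coeff_Qpoly)

lemma degree_Ppoly: "\<gamma> 0 = 1 \<Longrightarrow> degree (Ppoly \<gamma> K) = K"
  by (intro antisym degree_le le_degree) (auto simp: coeff_Ppoly)

lemma reflect_Qpoly:
  assumes "\<gamma> K \<noteq> 0"
  shows "reflect_poly (Qpoly \<gamma> K) = Ppoly \<gamma> K"
  by (rule poly_eqI) (use assms in \<open>auto simp: coeff_reflect_poly degree_Qpoly coeff_Qpoly coeff_Ppoly\<close>)

lemma reflect_Ppoly:
  assumes "\<gamma> 0 = 1" "\<gamma> K \<noteq> 0"
  shows "reflect_poly (Ppoly \<gamma> K) = Qpoly \<gamma> K"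
  using assms by (subst reflect_Qpoly[symmetric]) (auto simp: coeff_Qpoly)

text \<open>The coefficient of t^n in Q(t) e^{yt - t^2/4}. The range may end at n instead of K:
  beyond n the Hermite factor vanishes, beyond K the coefficient of Q.\<close>

lemma poly_qpoly_conv:
  "poly (qpoly \<gamma> K n) y = (\<Sum>j\<le>n. coeff (Qpoly \<gamma> K) j * poly (hat_hermite (int (n - j))) y)"
proof -
  have "poly (qpoly \<gamma> K n) y = (\<Sum>j = 0..K. \<gamma> j * poly (hat_hermite (int n - int j)) y)"
    by (simp add: qpoly_def poly_sum)
  also have "\<dots> = (\<Sum>j\<in>{0..K} \<inter> {..n}. \<gamma> j * poly (hat_hermite (int n - int j)) y)"
    by (rule sum.mono_neutral_right) (auto simp: hat_hermite_def)
  also have "\<dots> = (\<Sum>j\<in>{0..K} \<inter> {..n}. coeff (Qpoly \<gamma> K) j * poly (hat_hermite (int (n - j))) y)"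
    by (rule sum.cong) (auto simp: coeff_Qpoly of_nat_diff)
  also have "\<dots> = (\<Sum>j\<le>n. coeff (Qpoly \<gamma> K) j * poly (hat_hermite (int (n - j))) y)"
    by (rule sum.mono_neutral_left) (auto simp: coeff_Qpoly)
  finally show ?thesis .
qed

text \<open>The generating function $\sum_k q_k(y) t^k = Q(t) e^{yt - t^2/4}$ is not a polynomial in $t$:
  otherwise the differential equation it satisfies would be violated by degrees.\<close>

lemma qpoly_values_not_eventually_0:
  assumes \<gamma>: "\<gamma> 0 = 1" and zero: "\<And>k. k \<ge> n \<Longrightarrow> poly (qpoly \<gamma> K k) y = 0"
  shows False
proof -
  define Q where "Q = Qpoly \<gamma> K"
  define a where "a = (\<Sum>k<n. monom (poly (qpoly \<gamma> K k) y) k)"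
  \<comment> \<open>The logarithmic derivative of e^{yt - t^2/4}.\<close>
  define L where "L = [:y, - 1 / 2:]"
  define h where "h = Abs_fps (\<lambda>k. poly (hat_hermite (int k)) y)"
  have h': "fps_deriv h = fps_of_poly L * h"
  proof (rule fps_ext)
    fix k
    have "fps_nth (fps_of_poly L * h) k = y * fps_nth h k - (if k = 0 then 0 else fps_nth h (k - 1)) / 2"
      by (simp add: L_def fps_of_poly_pCons algebra_simps)
    also have "\<dots> = real (Suc k) * fps_nth h (Suc k)"
    proof (cases k)
      case 0
      then show ?thesis by (simp add: h_def hat_hermite_def)
    next
      case (Suc m)
      then show ?thesis using poly_hat_hermite_rec[of m y] by (simp add: h_def)
    qed
    finally show "fps_nth (fps_deriv h) k = fps_nth (fps_of_poly L * h) k" by simp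
  qed
  have coeff_a: "coeff a k = poly (qpoly \<gamma> K k) y" for k
    using zero[of k] by (auto simp: a_def coeff_sum)
  have aQ: "fps_of_poly a = fps_of_poly Q * h"
    by (rule fps_ext) (simp add: coeff_a fps_mult_nth h_def Q_def poly_qpoly_conv atMost_atLeast0)
  \<comment> \<open>The extra factor \<open>Q\<close> turns every product of \<open>Q\<close> and
    \<open>h\<close> back into \<open>a\<close>, leaving an identity between polynomials.\<close>
  have "fps_of_poly (Q * pderiv a) = fps_of_poly Q * fps_deriv (fps_of_poly Q * h)"
    by (simp add: fps_of_poly_mult fps_of_poly_pderiv aQ)
  also have "\<dots> = fps_of_poly (pderiv Q) * fps_of_poly a + fps_of_poly L * fps_of_poly Q * fps_of_poly a"
    by (simp add: h' fps_of_poly_pderiv aQ algebra_simps)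
  also have "\<dots> = fps_of_poly (pderiv Q * a + L * Q * a)"
    by (simp add: fps_of_poly_mult fps_of_poly_add)
  finally have eq: "L * Q * a = Q * pderiv a - pderiv Q * a"
    by (simp add: fps_of_poly_eq_iff)
  have nz: "a \<noteq> 0" "Q \<noteq> 0"
    using coeff_a[of 0] coeff_Qpoly[of \<gamma> K 0] \<gamma> by (auto simp: qpoly_0 Q_def)
  have "L \<noteq> 0" "degree L = 1" by (auto simp: L_def)
  then have "degree (L * Q * a) = 1 + degree Q + degree a"
    using nz by (simp add: degree_mult_eq)
  moreover have "degree (Q * pderiv a - pderiv Q * a) \<le> degree Q + degree a"
    by (rule degree_diff_le; rule order_trans[OF degree_mult_le]) (auto simp: degree_pderiv)
  ultimately show False unfolding eq by simp
qed

section \<open>The bounds on the number of non-real zeros of $q_n$\<close>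

text \<open>The polynomials $Q(t)(1 - t^2/(4m))^m$ converge coefficientwise to $Q(t) e^{-t^2/4}$. Their
  reversals $R$ have as many non-real zeros as $P$, and up to the limit $m \to \infty$ the polynomial
  $q_n$ is a derivative of the image of $R$ under the multiplier sequence $1/j!$.\<close>

lemma nonreal_zero_count_qpoly_le:
  assumes g: "\<gamma> 0 = 1" "\<gamma> K \<noteq> 0"
  shows "nonreal_zero_count (qpoly \<gamma> K n) \<le> nonreal_zero_count (Ppoly \<gamma> K)"
proof (rule nonreal_zero_count_limit_le)
  \<comment> \<open>This choice keeps m positive, for 1/m, and \<open>d l\<close> at least n, so
    that \<open>d l - n\<close> is not truncated.\<close>
  define m where "m l = Suc (n + l)" for l
  \<comment> \<open>Then \<open>U l\<close> is x^2 - 1/(4m), split into real linear factors, and it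
    reverses to 1 - t^2/(4m).\<close>
  define a where "a l = 1 / (2 * sqrt (real (m l)))" for l
  define U where "U l = [:- a l, 1:] * [:a l, 1:]" for l
  define R where "R l = Ppoly \<gamma> K * U l ^ m l" for l
  define d where "d l = K + 2 * m l" for l
  \<comment> \<open>The factor (i + d - n)!/i! from the derivatives cancels the factorial in
    \<open>borel_poly\<close>. What remains is the coefficient of t^(n-i) in the reversal of R, over
    i!, as in \<open>coeff_qpoly\<close>.\<close>
  define f where "f l = (pderiv ^^ (d l - n)) (borel_poly (R l))" for l
  have dn: "n \<le> d l" for l by (simp add: d_def m_def)
  have a2: "a l * a l = 1 / 4 * inverse (real (m l))" for l
  proof -
    have "a l * a l = 1 / (4 * (sqrt (real (m l)) * sqrt (real (m l))))" by (simp add: a_def)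
    then show ?thesis by (simp add: inverse_eq_divide)
  qed
  have U: "U l = [:- (1 / 4 * inverse (real (m l))), 0, 1:]" for l
  proof -
    have "U l = [:- (a l * a l), 0, 1:]" by (simp add: U_def)
    then show ?thesis unfolding a2 .
  qed
  have P0: "Ppoly \<gamma> K \<noteq> 0" using coeff_Ppoly[of \<gamma> K K] g by auto
  have degR: "degree (R l) = d l" for l
    unfolding R_def using P0 g
    by (subst degree_mult_eq) (simp_all add: U degree_power_eq degree_Ppoly d_def)
  have R0: "R l \<noteq> 0" for l using P0 by (simp add: R_def U)
  have countR: "nonreal_zero_count (R l) = nonreal_zero_count (Ppoly \<gamma> K)" for l
  proof -
    have "nonreal_zero_count (U l) = 0"
      unfolding U_def by (subst nonreal_zero_count_mult) simp_all
    moreover have "U l \<noteq> 0" by (simp add: U)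
    ultimately show ?thesis
      using P0 by (simp add: R_def nonreal_zero_count_mult nonreal_zero_count_power)
  qed
  have coeff_U: "(\<lambda>l. coeff (reflect_poly (U l) ^ m l) k) \<longlonglongrightarrow> poly (hat_hermite (int k)) 0" for k
  proof -
    have rU: "reflect_poly (U l) = monom (- (1 / 4 * inverse (real (m l)))) 2 + 1" for l
      by (rule poly_eqI) (auto simp: U coeff_reflect_poly coeff_pCons numeral_2_eq_2 split: nat.splits)
    have "coeff (reflect_poly (U l) ^ m l) k =
        (\<Sum>i\<le>m l. if 2 * i = k then real (m l choose i) * (- (1 / 4 * inverse (real (m l)))) ^ i else 0)" for l
      unfolding rU binomial_ring by (simp add: coeff_sum monom_power of_nat_poly mult.commute[of _ "2::nat"] if_distrib cong: if_cong)
    note c = this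
    show ?thesis
    proof (cases "even k")
      case False
      then have "coeff (reflect_poly (U l) ^ m l) k = 0" for l
        unfolding c by (intro sum.neutral) auto
      moreover obtain i where "k = 2 * i + 1" using False by (elim oddE)
      ultimately show ?thesis using poly_hat_hermite_0(2)[of i] by simp
    next
      case True
      then obtain i where k: "k = 2 * i" by (elim evenE)
      have c': "coeff (reflect_poly (U l) ^ m l) k = real (m l choose i) / real (m l) ^ i * (- 1 / 4) ^ i" for l
      proof -
        have "coeff (reflect_poly (U l) ^ m l) k = real (m l choose i) * (- (1 / 4 * inverse (real (m l)))) ^ i"
          using c[of l] by (simp add: k binomial_eq_0)
        also have "- (1 / 4 * inverse (real (m l))) = (- 1 / 4) / real (m l)"
          by (simp add: inverse_eq_divide)
        finally show ?thesis unfolding power_divide by (simp add: mult_ac)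
      qed
      have m: "m l = l + Suc n" for l by (simp add: m_def)
      have "(\<lambda>l. real (m l choose i) / real (m l) ^ i) \<longlonglongrightarrow> 1 / fact i"
        unfolding m by (rule LIMSEQ_ignore_initial_segment[OF tendsto_binomial_over_power])
      then have "(\<lambda>l. real (m l choose i) / real (m l) ^ i * (- 1 / 4) ^ i) \<longlonglongrightarrow> 1 / fact i * (- 1 / 4) ^ i"
        by (intro tendsto_mult tendsto_const)
      then show ?thesis unfolding c' unfolding k poly_hat_hermite_0 by simp
    qed
  qed
  have reflR: "reflect_poly (R l) = Qpoly \<gamma> K * reflect_poly (U l) ^ m l" for l
    using g by (simp add: R_def reflect_poly_mult reflect_poly_power reflect_Ppoly)
  have coeff_f: "coeff (f l) i = (if i \<le> n then coeff (reflect_poly (R l)) (n - i) / fact i else 0)" for l i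
  proof -
    have "coeff (f l) i = (pochhammer (real (Suc i)) (d l - n) / fact (i + (d l - n))) * coeff (R l) (i + (d l - n))"
      by (simp add: f_def coeff_higher_pderiv del: of_nat_Suc)
    also have "pochhammer (real (Suc i)) (d l - n) / fact (i + (d l - n)) = 1 / fact i"
      using pochhammer_Suc_fact[of i "d l - n"] by (simp add: divide_simps del: of_nat_Suc)
    also have "coeff (R l) (i + (d l - n)) = (if i \<le> n then coeff (reflect_poly (R l)) (n - i) else 0)"
    proof (cases "i \<le> n")
      case True
      then have "i + (d l - n) = d l - (n - i)" "n - i \<le> d l" using dn[of l] by auto
      then show ?thesis using True by (simp add: coeff_reflect_poly degR)
    next
      case False
      then show ?thesis using dn[of l] by (simp add: coeff_eq_0 degR)
    qed
    finally show ?thesis by simp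
  qed
  show "(\<lambda>l. coeff (f l) i) \<longlonglongrightarrow> coeff (qpoly \<gamma> K n) i" for i
  proof (cases "i \<le> n")
    case True
    have "(\<lambda>l. (\<Sum>j\<le>n - i. coeff (Qpoly \<gamma> K) j * coeff (reflect_poly (U l) ^ m l) (n - i - j)) / fact i)
        \<longlonglongrightarrow> poly (qpoly \<gamma> K (n - i)) 0 / fact i"
      unfolding poly_qpoly_conv by (intro tendsto_intros coeff_U) auto
    then show ?thesis using True g(1)
      by (simp add: coeff_f coeff_qpoly[where \<gamma> = \<gamma>] reflR coeff_mult)
  next
    case False
    then show ?thesis using g(1) by (simp add: coeff_f coeff_qpoly[where \<gamma> = \<gamma>])
  qed
  have "coeff (f l) n \<noteq> 0" for l using R0[of l] by (simp add: coeff_f)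
  then show "f l \<noteq> 0" for l by (metis coeff_0)
  show "degree (f l) \<le> n" for l by (rule degree_le) (simp add: coeff_f)
  show "qpoly \<gamma> K n \<noteq> 0" using g(1) by (rule qpoly_neq_0)
  show "nonreal_zero_count (f l) \<le> nonreal_zero_count (Ppoly \<gamma> K)" for l
    using nonreal_zero_count_higher_pderiv_le[of "d l - n" "borel_poly (R l)"]
      nonreal_zero_count_borel_poly_le[OF R0[of l]]
    by (simp add: f_def countR)
qed

text \<open>Nonzero terms occur only at k = 2i + j, so the exponential series is reindexed along i;
  the value 0 at negative indices covers k < j.\<close>

lemma hat_hermite_0_sums:
  "(\<lambda>k. of_real (poly (hat_hermite (int k - int j)) 0) * z ^ k) sums (z ^ j * exp (- (z\<^sup>2) / 4 :: complex))"
proof -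
  have "(\<lambda>i. z ^ j * ((- (z\<^sup>2) / 4) ^ i /\<^sub>R fact i)) sums (z ^ j * exp (- (z\<^sup>2) / 4))"
    by (intro sums_mult exp_converges)
  moreover have "z ^ j * ((- (z\<^sup>2) / 4) ^ i /\<^sub>R fact i) =
      of_real (poly (hat_hermite (int (2 * i + j) - int j)) 0) * z ^ (2 * i + j)" for i
  proof -
    have "int (2 * i + j) - int j = int (2 * i)" by simp
    moreover have "(- (z\<^sup>2) / 4) ^ i = (- 1 / 4) ^ i * z ^ (2 * i)"
      by (simp add: power_mult power_mult_distrib[symmetric])
    ultimately show ?thesis
      by (simp only: poly_hat_hermite_0) (simp add: scaleR_conv_of_real power_add field_simps)
  qed
  ultimately have "(\<lambda>i. of_real (poly (hat_hermite (int (2 * i + j) - int j)) 0) * z ^ (2 * i + j))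
      sums (z ^ j * exp (- (z\<^sup>2) / 4))" by simp
  moreover have "of_real (poly (hat_hermite (int k - int j)) 0) * z ^ k = 0"
    if "k \<notin> range (\<lambda>i. 2 * i + j)" for k
  proof (cases "k < j")
    case True
    then show ?thesis by (simp add: hat_hermite_def)
  next
    case False
    then obtain l where l: "k = l + j" by (metis le_Suc_ex not_less add.commute)
    have "odd l" using that l by (auto elim!: evenE)
    then obtain i where i: "l = 2 * i + 1" by (elim oddE)
    have "int k - int j = int (2 * i + 1)" using l i by simp
    then show ?thesis using poly_hat_hermite_0(2)[of i] by (simp only:) simp
  qed
  ultimately show ?thesis
    using sums_mono_reindex[of "\<lambda>i. 2 * i + j" "\<lambda>k. of_real (poly (hat_hermite (int k - int j)) 0) * z ^ k"]
    by (simp add: strict_mono_def)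
qed

lemma qpoly_0_sums:
  "(\<lambda>k. of_real (poly (qpoly \<gamma> K k) 0) * z ^ k) sums (poly (cpoly (Qpoly \<gamma> K)) z * exp (- (z\<^sup>2) / 4))"
proof -
  have "(\<lambda>k. \<Sum>j = 0..K. of_real (\<gamma> j) * (of_real (poly (hat_hermite (int k - int j)) 0) * z ^ k))
      sums (\<Sum>j = 0..K. of_real (\<gamma> j) * (z ^ j * exp (- (z\<^sup>2) / 4)))"
    by (intro sums_sum sums_mult hat_hermite_0_sums)
  moreover have "poly (cpoly (Qpoly \<gamma> K)) z = (\<Sum>j = 0..K. of_real (\<gamma> j) * z ^ j)"
  proof -
    have "cpoly (Qpoly \<gamma> K) = (\<Sum>j = 0..K. monom (of_real (\<gamma> j)) j)"
      by (rule poly_eqI) (auto simp: coeff_Qpoly coeff_sum)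
    then show ?thesis by (simp add: poly_sum poly_monom)
  qed
  ultimately show ?thesis
    by (simp add: qpoly_def poly_sum sum_distrib_left sum_distrib_right mult_ac)
qed

text \<open>Reversing and rescaling gives $n!\,n^{-n} w^n q_n(n/w) \to Q(w) e^{-w^2/4}$ locally uniformly.\<close>

lemma ex_nonreal_zero_count_qpoly_ge:
  assumes g: "\<gamma> 0 = 1" "\<gamma> K \<noteq> 0"
  shows "\<exists>n. nonreal_zero_count (Ppoly \<gamma> K) \<le> nonreal_zero_count (qpoly \<gamma> K n)"
proof -
  define \<phi> where "\<phi> k = poly (qpoly \<gamma> K k) 0" for k
  \<comment> \<open>With n = \<open>Suc l\<close>, the factor n!/n^n makes the coefficient of w^k
    equal to q_k(0) times n!/((n-k)! n^k), which tends to q_k(0).\<close>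
  define G where "G l = smult (fact (Suc l) / real (Suc l) ^ Suc l)
    (reflect_poly (pcompose (qpoly \<gamma> K (Suc l)) [:0, real (Suc l):]))" for l
  have q0: "qpoly \<gamma> K n \<noteq> 0" for n using g(1) by (rule qpoly_neq_0)
  have pc0: "pcompose (qpoly \<gamma> K (Suc l)) [:0, real (Suc l):] \<noteq> 0" for l
    using q0 by (simp add: pcompose_eq_0_iff)
  have G0: "G l \<noteq> 0" for l using pc0[of l] by (simp add: G_def)
  have countG: "nonreal_zero_count (G l) = nonreal_zero_count (qpoly \<gamma> K (Suc l))" for l
    using pc0[of l] q0 unfolding G_def
    by (subst nonreal_zero_count_smult)
      (simp_all add: nonreal_zero_count_reflect_poly nonreal_zero_count_scale del: of_nat_Suc)
  have coeff_G: "coeff (G l) k = \<phi> k * (fact k * (real (Suc l choose k) / real (Suc l) ^ k))" for l k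
  proof (cases "k \<le> Suc l")
    case True
    define n where "n = Suc l"
    then have "n \<noteq> 0" by simp
    have "coeff (G l) k = fact n / real n ^ n * (real n ^ (n - k) * (\<phi> k / fact (n - k)))"
      using True g(1) \<open>n \<noteq> 0\<close>
      by (simp add: G_def n_def[symmetric] coeff_reflect_poly degree_pcompose degree_qpoly[where \<gamma> = \<gamma>]
          coeff_pcompose_linear coeff_qpoly[where \<gamma> = \<gamma>] \<phi>_def)
    also have "real n ^ n = real n ^ (n - k) * real n ^ k"
      using True by (simp add: n_def flip: power_add)
    also have "fact n / (real n ^ (n - k) * real n ^ k) * (real n ^ (n - k) * (\<phi> k / fact (n - k))) =
        \<phi> k * (fact k * ((fact n / (fact k * fact (n - k))) / real n ^ k))"
      by (simp add: n_def field_simps del: of_nat_Suc fact_Suc)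
    also have "fact n / (fact k * fact (n - k)) = real (n choose k)"
      using True by (simp add: n_def binomial_fact del: fact_Suc)
    finally show ?thesis by (simp only: n_def)
  next
    case False
    have "degree (G l) \<le> Suc l"
      unfolding G_def using degree_reflect_poly_le[of "pcompose (qpoly \<gamma> K (Suc l)) [:0, real (Suc l):]"] g(1)
      by (intro order_trans[OF degree_smult_le]) (simp add: degree_pcompose degree_qpoly[where \<gamma> = \<gamma>])
    then show ?thesis using False by (simp add: coeff_eq_0 binomial_eq_0 del: of_nat_Suc)
  qed
  have "uniform_limit (cball 0 \<rho>) (\<lambda>l. poly (cpoly (G l)))
      (\<lambda>z. poly (cpoly (Qpoly \<gamma> K)) z * exp (- (z\<^sup>2) / 4)) sequentially" for \<rho>
  proof (rule uniform_limit_poly_dominated)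
    show "norm (coeff (cpoly (G l)) k) \<le> \<bar>\<phi> k\<bar>" for l k
    proof -
      \<comment> \<open>Since n!/(n-k)! is at most n^k, the numbers |q_k(0)| form a common
        majorant.\<close>
      have "real (fact k * (Suc l choose k)) \<le> real (Suc l ^ k)"
        using binomial_fact_pow[of "Suc l" k] by (simp only: of_nat_le_iff mult.commute)
      then have "fact k * (real (Suc l choose k) / real (Suc l) ^ k) \<le> 1"
        by (simp add: divide_le_eq del: of_nat_Suc binomial_Suc_Suc)
      moreover have "0 \<le> fact k * (real (Suc l choose k) / real (Suc l) ^ k)" by simp
      ultimately show ?thesis
        unfolding coeff_cpoly coeff_G norm_of_real abs_mult[of "\<phi> k"]
        by (intro mult_left_le) auto
    qed
    show "summable (\<lambda>k. \<bar>\<phi> k\<bar> * \<rho> ^ k)" if "\<rho> > 0" for \<rho>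
    proof -
      \<comment> \<open>Convergence at the larger radius gives absolute convergence at
        \<open>\<rho>\<close>.\<close>
      have "summable (\<lambda>k. of_real (\<phi> k) * of_real (\<rho> + 1) ^ k :: complex)"
        using sums_summable[OF qpoly_0_sums] unfolding \<phi>_def .
      from powser_insidea[OF this, of "of_real \<rho>"] that show ?thesis
        by (simp add: norm_mult norm_power)
    qed
    show "(\<lambda>l. coeff (cpoly (G l)) k) \<longlonglongrightarrow> of_real (\<phi> k)" for k
    proof -
      have "(\<lambda>l. \<phi> k * (fact k * (real (Suc l choose k) / real (Suc l) ^ k))) \<longlonglongrightarrow> \<phi> k * (fact k * (1 / fact k))"
        by (intro tendsto_mult tendsto_const LIMSEQ_Suc[OF tendsto_binomial_over_power])
      then show ?thesis unfolding coeff_cpoly coeff_G by (intro tendsto_of_real) simp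
    qed
    show "(\<lambda>k. of_real (\<phi> k) * z ^ k) sums (poly (cpoly (Qpoly \<gamma> K)) z * exp (- (z\<^sup>2) / 4))" for z
      unfolding \<phi>_def by (rule qpoly_0_sums)
  qed
  moreover have Q0: "Qpoly \<gamma> K \<noteq> 0" using coeff_Qpoly[of \<gamma> K 0] g by auto
  ultimately have "\<forall>\<^sub>F l in sequentially. nonreal_order_sum (cpoly (Qpoly \<gamma> K)) \<le> nonreal_order_sum (cpoly (G l))"
    using G0 by (intro nonreal_order_sum_le_eventually[where E = "\<lambda>z. exp (- (z\<^sup>2) / 4)"])
      (auto intro!: holomorphic_intros)
  then obtain l where "nonreal_zero_count (Qpoly \<gamma> K) \<le> nonreal_zero_count (G l)"
    using eventually_happens'[OF sequentially_bot] unfolding nonreal_zero_count_eq by blast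
  moreover have "nonreal_zero_count (Qpoly \<gamma> K) = nonreal_zero_count (Ppoly \<gamma> K)"
    using nonreal_zero_count_reflect_poly[OF Q0] reflect_Qpoly[where \<gamma> = \<gamma>, OF g(2)] by simp
  ultimately show ?thesis using countG by metis
qed

text \<open>By the equality case of Rolle's count, a multiple zero of $q_n$ would be a multiple zero of
  every $q_m$ with $m \ge n$.\<close>

lemma qpoly_simple_and_interlaces:
  assumes \<gamma>: "\<gamma> 0 = 1"
    and const: "\<And>m. m \<ge> n0 \<Longrightarrow> nonreal_zero_count (qpoly \<gamma> K m) = N"
    and n: "n \<ge> n0"
  shows "\<forall>x\<in>real_zeros (qpoly \<gamma> K n). order x (qpoly \<gamma> K n) = 1"
    and "interlaces (real_zeros (qpoly \<gamma> K (Suc n))) (real_zeros (qpoly \<gamma> K n))"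
proof -
  have q0: "qpoly \<gamma> K m \<noteq> 0" for m using \<gamma> by (rule qpoly_neq_0)
  have deg: "degree (qpoly \<gamma> K (Suc m)) > 0" for m using \<gamma> by (simp add: degree_qpoly[where \<gamma> = \<gamma>])
  have same: "nonreal_zero_count (pderiv (qpoly \<gamma> K (Suc m))) = nonreal_zero_count (qpoly \<gamma> K (Suc m))"
    if "m \<ge> n0" for m using that const[of m] const[of "Suc m"] by (simp add: pderiv_qpoly)
  have simple: "order x (qpoly \<gamma> K m) = 1" if x: "poly (qpoly \<gamma> K m) x = 0" and m: "m \<ge> n0" for x m
  proof (rule ccontr)
    assume ne: "order x (qpoly \<gamma> K m) \<noteq> 1"
    have "poly (qpoly \<gamma> K (m + k)) x = 0 \<and> order x (qpoly \<gamma> K (m + k)) \<noteq> 1" for k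
    proof (induction k)
      case (Suc k)
      \<comment> \<open>By the equality case, a non-simple zero of the derivative must be a zero of
        the polynomial itself; there the order is one higher, hence again not 1.\<close>
      have root: "poly (qpoly \<gamma> K (Suc (m + k))) x = 0"
        using pderiv_same_nonreal_zero_count(1)[OF deg same, of "m + k" x] Suc m
        by (auto simp: pderiv_qpoly)
      have "order x (qpoly \<gamma> K (Suc (m + k))) = Suc (order x (qpoly \<gamma> K (m + k)))"
        using order_pderiv[OF q0 root] by (simp add: pderiv_qpoly)
      then show ?case using root Suc q0 by (simp add: order_root)
    qed (use x ne in simp)
    then show False
      using qpoly_values_not_eventually_0[where \<gamma> = \<gamma>, OF \<gamma>, of m K x] by (metis le_Suc_ex)
  qed
  show "\<forall>x\<in>real_zeros (qpoly \<gamma> K n). order x (qpoly \<gamma> K n) = 1"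
    using simple n by (simp add: real_zeros_def)
  \<comment> \<open>Simplicity at level n + 1 excludes common zeros of q_{n+1} and q_n, as
    interlacing requires.\<close>
  have "poly (qpoly \<gamma> K n) x \<noteq> 0" if "poly (qpoly \<gamma> K (Suc n)) x = 0" for x
    using order_pderiv[OF q0 that] simple[OF that] n q0 by (simp add: pderiv_qpoly order_root)
  then show "interlaces (real_zeros (qpoly \<gamma> K (Suc n))) (real_zeros (qpoly \<gamma> K n))"
    using pderiv_same_nonreal_zero_count(2)[OF deg same[OF n]] by (simp add: pderiv_qpoly)
qed

lemma nonreal_zero_count_eq_0_iff:
  assumes "p \<noteq> 0"
  shows "nonreal_zero_count p = 0 \<longleftrightarrow> (\<forall>z. poly (cpoly p) z = 0 \<longrightarrow> Im z = 0)"
proof -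
  have "finite {z. poly (cpoly p) z = 0 \<and> Im z \<noteq> 0}"
    using assms by (intro finite_subset[OF _ poly_roots_finite[of "cpoly p"]]) auto
  then have "nonreal_zero_count p = 0 \<longleftrightarrow>
      (\<forall>z\<in>{z. poly (cpoly p) z = 0 \<and> Im z \<noteq> 0}. order z (cpoly p) = 0)"
    unfolding nonreal_zero_count_def by (rule sum_eq_0_iff)
  moreover have "order z (cpoly p) \<noteq> 0" if "poly (cpoly p) z = 0" for z
    using that assms by (simp add: order_root)
  ultimately show ?thesis by blast
qed

theorem theorem1p3:
  fixes K :: nat and \<gamma> :: "nat \<Rightarrow> real"
  assumes "K > 0" and "\<gamma> 0 = 1" and "\<gamma> K \<noteq> 0"
  defines "N \<equiv> nonreal_zero_count (Ppoly \<gamma> K)"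
  shows
    "((\<forall>n. \<forall>z. poly (map_poly complex_of_real (qpoly \<gamma> K n)) z = 0 \<longrightarrow> Im z = 0)
        \<longleftrightarrow> N = 0)
     \<and> (N = 0 \<longrightarrow>
          (\<forall>n. (\<forall>x\<in>real_zeros (qpoly \<gamma> K n). order x (qpoly \<gamma> K n) = 1) \<and>
               interlaces (real_zeros (qpoly \<gamma> K (Suc n))) (real_zeros (qpoly \<gamma> K n))))
     \<and> (N > 0 \<longrightarrow>
          (\<exists>n. nonreal_zero_count (qpoly \<gamma> K n) = N) \<and>
          (let n0 = (LEAST n. nonreal_zero_count (qpoly \<gamma> K n) = N) in
             (\<forall>n. (int (real_zero_count (qpoly \<gamma> K n)) = int n - int N \<and>
                   nonreal_zero_count (qpoly \<gamma> K n) = N) \<longleftrightarrow> n \<ge> n0) \<and>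
             (\<forall>n\<ge>n0. (\<forall>x\<in>real_zeros (qpoly \<gamma> K n). order x (qpoly \<gamma> K n) = 1) \<and>
                   interlaces (real_zeros (qpoly \<gamma> K (Suc n))) (real_zeros (qpoly \<gamma> K n)))))"
proof -
  define c where "c n = nonreal_zero_count (qpoly \<gamma> K n)" for n
  define n0 where "n0 = (LEAST n. c n = N)"
  have q0: "qpoly \<gamma> K n \<noteq> 0" for n using assms(2) by (rule qpoly_neq_0)
  have le: "c n \<le> N" for n unfolding c_def N_def by (rule nonreal_zero_count_qpoly_le) fact+
  have "mono c"
    unfolding mono_iff_le_Suc c_def
    using nonreal_zero_count_pderiv_le[of "qpoly \<gamma> K (Suc n)" for n] by (simp add: pderiv_qpoly)
  obtain n1 where "N \<le> c n1"
    using ex_nonreal_zero_count_qpoly_ge[of \<gamma> K] assms by (auto simp: c_def)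
  then have "c n1 = N" using le[of n1] by simp
  then have "c n0 = N" unfolding n0_def by (rule LeastI)
  \<comment> \<open>\<open>c\<close> is nondecreasing, at most N, and equal to N at
    \<open>n0\<close>, hence constant from there on.\<close>
  then have ge: "c n = N" if "n \<ge> n0" for n using monoD[OF \<open>mono c\<close> that] le[of n] by simp
  have iff: "c n = N \<longleftrightarrow> n0 \<le> n" for n
    using ge[of n] Least_le[of "\<lambda>n. c n = N" n, folded n0_def] by blast
  have deg: "degree (qpoly \<gamma> K n) = n" for n using assms(2) by (rule degree_qpoly)
  have real: "int (real_zero_count (qpoly \<gamma> K n)) = int n - int (c n)" for n
    using real_plus_nonreal_zero_count[OF q0, of n] unfolding c_def deg by linarith
  have nice: "(\<forall>x\<in>real_zeros (qpoly \<gamma> K n). order x (qpoly \<gamma> K n) = 1) \<and>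
      interlaces (real_zeros (qpoly \<gamma> K (Suc n))) (real_zeros (qpoly \<gamma> K n))" if "n \<ge> n0" for n
    using qpoly_simple_and_interlaces[where \<gamma> = \<gamma> and K = K and N = N, OF assms(2) _ that] ge
    unfolding c_def by blast
  have all_real: "(\<forall>n. \<forall>z. poly (cpoly (qpoly \<gamma> K n)) z = 0 \<longrightarrow> Im z = 0) \<longleftrightarrow> N = 0"
  proof -
    have "(\<forall>n. \<forall>z. poly (cpoly (qpoly \<gamma> K n)) z = 0 \<longrightarrow> Im z = 0) \<longleftrightarrow> (\<forall>n. c n = 0)"
      unfolding c_def using nonreal_zero_count_eq_0_iff[OF q0] by simp
    also have "\<dots> \<longleftrightarrow> N = 0" using le \<open>c n0 = N\<close> by (metis le_zero_eq)
    finally show ?thesis .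
  qed
  \<comment> \<open>Simplicity and interlacing in the all-real case are thus the instance
    \<open>n0\<close> = 0 of \<open>nice\<close>.\<close>
  have zero: "n0 = 0" if "N = 0" using iff[of 0] le[of 0] that by simp
  show ?thesis
    unfolding Let_def c_def[symmetric] n0_def[symmetric]
  proof (intro conjI impI allI)
    show "(\<forall>n z. poly (cpoly (qpoly \<gamma> K n)) z = 0 \<longrightarrow> Im z = 0) \<longleftrightarrow> N = 0"
      by (rule all_real)
    show "\<exists>n. c n = N" using \<open>c n1 = N\<close> by blast
    show "(int (real_zero_count (qpoly \<gamma> K n)) = int n - int N \<and> c n = N) \<longleftrightarrow> n0 \<le> n" for n
      using real[of n] iff[of n] by auto
  qed (use nice zero in auto)
qed

end
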